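(* Let $\Lambda$ be a commutative Noetherian domain over $\mathsf{k}$, $L=\operatorname{Frac}\Lambda$, let $W$ be a finite subgroup of $\operatorname{Aut}_{\mathsf{k}}\Lambda$ and $\mathcal{M}$ a subgroup of $\operatorname{Aut}_{\mathsf{k}}\Lambda$ such that $W$ normalizes $\mathcal{M}$, acts faithfully on $\mathcal{M}$ (by conjugation), and $\mathcal{M}\cap W=1$. Let $U$ be a Galois order over $\Lambda$ in $L*(\mathcal{M}\rtimes W)$ containing the group algebra $\mathsf{k}W$, and let $e=\frac{1}{|W|}\sum_{w\in W}w$. Then $eUe$ is a Galois order over $\Lambda^W$ in $(L*\mathcal{M})^W$.
   Context: $\mathsf{k}$ is an algebraically closed field of characteristic zero; all rings are $\mathsf{k}$-algebras. One uses the isomorphisms $e\Lambda^W e\simeq\Lambda^W$ and $e(L*(\mathcal{M}\rtimes W))e\simeq(L*\mathcal{M})^W$ to regard $eUe\subset(L*\mathcal{M})^W$. Galois rings and orders: let $U$ be an associative algebra, $\Gamma\subset U$ a commutative subalgebra which is a Noetherian domain, with $U$ finitely generated as a $\Gamma$-algebra; $K=\operatorname{Frac}\Gamma$; $L$ a finite Galois extension of $K$ with Galois group $G$; $\mathcal{N}$ a submonoid of $\operatorname{Aut}_{\mathsf{k}}L$ which is separating (if $m,m'\in\mathcal{N}$ have the same restriction to $K$ then $m=m'$) and stable under conjugation by $G$. $L*\mathcal{N}$ is the skew monoid ring ($m\,l=m(l)\,m$), on which $G$ acts by $g(lm)=g(l)\,gmg^{-1}$, and $\mathcal{K}=(L*\mathcal{N})^G$.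 $U$ is a Galois $\Gamma$-ring in $\mathcal{K}$ if $\Gamma\subset U\subset\mathcal{K}$ and $UK=KU=\mathcal{K}$. It is a Galois order over $\Gamma$ in $\mathcal{K}$ if moreover for every finite dimensional left (respectively right) $K$-subspace $V\subset\mathcal{K}$, the intersection $U\cap V$ is a finitely generated left (respectively right) $\Gamma$-module. For $U$ over $\Lambda$ in $L*(\mathcal{M}\rtimes W)$ the relevant group $G$ is trivial and $K=L$; for $eUe$ over $\Lambda^W$ in $(L*\mathcal{M})^W$ the group is $G=W$ and $K=L^W$.
   Formalization: Finite generation of eUe as a Λ^W-algebra, a standing assumption when Galois orders are defined, is not part of the conclusion, since it can fail even when U is finitely generated over Λ; all other conditions of a Galois order are proved. *)

theory Defs
  imports "HOL-Computational_Algebra.Computational_Algebra" "HOL.Hull"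
begin

section \<open>Automorphisms of a field\<close>

text \<open>Multiplicativity and bijectivity force \<open>\<sigma> 1 = 1\<close>, so this is the usual notion.\<close>

typedef (overloaded) 'a aut =
  "{\<sigma> :: 'a::field \<Rightarrow> 'a. bij \<sigma> \<and> (\<forall>x y. \<sigma> (x + y) = \<sigma> x + \<sigma> y) \<and> (\<forall>x y. \<sigma> (x * y) = \<sigma> x * \<sigma> y)}"
  morphisms app Abs_aut
  by (rule exI[of _ id]) (auto simp: bij_def)

setup_lifting type_definition_aut

lemma aut_eqI: "(\<And>x. app g x = app h x) \<Longrightarrow> g = h"
  by (metis app_inject ext)

lemma app_add [simp]: "app g (x + y) = app g x + app g y"
  and app_mult [simp]: "app g (x * y) = app g x * app g y"
  and bij_app: "bij (app g)"
  using app[of g] by auto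

lemma app_0 [simp]: "app g 0 = 0"
  using app_add[of g 0 0] by (metis add_0 add_cancel_left_left)

lemma app_eq_0_iff [simp]: "app g x = 0 \<longleftrightarrow> x = 0"
  by (metis app_0 bij_app bij_def inj_eq)

lemma app_1 [simp]: "app g 1 = 1"
proof -
  have "app g 1 * app g 1 = app g 1 * 1"
    using app_mult[of g 1 1] by (simp del: app_mult)
  then show ?thesis by (subst (asm) mult_cancel_left) simp
qed

lemma app_minus [simp]: "app g (- x) = - app g x"
  by (metis add.right_inverse add_eq_0_iff app_0 app_add)

lemma app_sum: "app g (\<Sum>i\<in>I. f i) = (\<Sum>i\<in>I. app g (f i))"
  by (induction I rule: infinite_finite_induct) auto

instantiation aut :: (field) "{monoid_mult, inverse}"
begin

lift_definition one_aut :: "'a aut" is id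
  by (auto simp: bij_def)

lift_definition times_aut :: "'a aut \<Rightarrow> 'a aut \<Rightarrow> 'a aut" is "(\<circ>)"
  by (auto intro: bij_comp)

lift_definition inverse_aut :: "'a aut \<Rightarrow> 'a aut" is inv
proof -
  fix f :: "'a \<Rightarrow> 'a"
  assume f: "bij f \<and> (\<forall>x y. f (x + y) = f x + f y) \<and> (\<forall>x y. f (x * y) = f x * f y)"
  then have s: "f (inv f x) = x" for x by (simp add: bij_is_surj surj_f_inv_f)
  have i: "inv f (f x) = x" for x using f by (simp add: bij_is_inj)
  have "inv f (x + y) = inv f x + inv f y" for x y
    using f s i by metis
  moreover have "inv f (x * y) = inv f x * inv f y" for x y
    using f s i by metis
  ultimately show "bij (inv f) \<and> (\<forall>x y. inv f (x + y) = inv f x + inv f y)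
      \<and> (\<forall>x y. inv f (x * y) = inv f x * inv f y)"
    using f by (simp add: bij_imp_bij_inv)
qed

definition divide_aut :: "'a aut \<Rightarrow> 'a aut \<Rightarrow> 'a aut"
  where "divide_aut g h = g * inverse h"

instance
  by standard (transfer, auto)+

end

lemma app_one [simp]: "app 1 x = x"
  by transfer simp

lemma app_times [simp]: "app (g * h) x = app g (app h x)"
  by transfer simp

lemma aut_left_inverse [simp]: "inverse g * g = (1 :: 'a::field aut)"
  by transfer (auto simp: bij_is_inj)

lemma aut_right_inverse [simp]: "g * inverse g = (1 :: 'a::field aut)"
  by transfer (simp add: bij_is_surj surj_iff [symmetric])

lemma aut_left_inverse_assoc [simp]: "inverse g * (g * h) = (h :: 'a::field aut)"
  by (simp add: mult.assoc [symmetric])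

lemma aut_right_inverse_assoc [simp]: "g * (inverse g * h) = (h :: 'a::field aut)"
  by (simp add: mult.assoc [symmetric])

lemma aut_inverse_times: "inverse (g * h) = inverse h * (inverse g :: 'a::field aut)"
proof -
  have "inverse (g * h) = inverse (g * h) * (g * h * (inverse h * inverse g))"
    by (simp add: mult.assoc)
  then show ?thesis by simp
qed

lemma aut_inverse_inverse [simp]: "inverse (inverse g) = (g :: 'a::field aut)"
  by (metis aut_left_inverse_assoc aut_right_inverse mult.right_neutral)

lemma aut_cancel_left: "g * h = g * k \<longleftrightarrow> h = (k :: 'a::field aut)"
  by (metis aut_left_inverse_assoc)

lemma aut_cancel_right: "h * g = k * g \<longleftrightarrow> h = (k :: 'a::field aut)"
  by (metis aut_right_inverse mult.assoc mult.right_neutral)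

lemma aut_inverse_one [simp]: "inverse 1 = (1 :: 'a::field aut)"
  by (metis aut_right_inverse mult.left_neutral)

definition submonoid :: "'a::monoid_mult set \<Rightarrow> bool"
  where "submonoid N \<longleftrightarrow> 1 \<in> N \<and> (\<forall>m\<in>N. \<forall>n\<in>N. m * n \<in> N)"

definition subgroup :: "'a::field aut set \<Rightarrow> bool"
  where "subgroup H \<longleftrightarrow> submonoid H \<and> (\<forall>h\<in>H. inverse h \<in> H)"

section \<open>The skew group ring of all automorphisms of a field\<close>

text \<open>
  An element is a formal sum \<open>\<Sum>m. a\<^sub>m m\<close> with coefficients on the left, given by its finitely
  supported coefficient function.  For a monoid \<open>N\<close> of automorphisms, \<open>L * N\<close> is the subring of
  elements supported in \<open>N\<close>.
\<close>

typedef (overloaded) 'a skew = "{f :: 'a::field aut \<Rightarrow> 'a. finite {m. f m \<noteq> 0}}"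
  morphisms coeff Abs_skew
  by (rule exI[of _ "\<lambda>_. 0"]) simp

setup_lifting type_definition_skew

hide_const (open) Polynomial.coeff

definition supp :: "'a::field skew \<Rightarrow> 'a aut set"
  where "supp x = {m. coeff x m \<noteq> 0}"

lemma finite_supp [simp]: "finite (supp x)"
  using coeff[of x] by (simp add: supp_def)

lemma skew_eqI: "(\<And>m. coeff x m = coeff y m) \<Longrightarrow> x = y"
  by (metis coeff_inject ext)

lemma coeff_outside: "m \<notin> supp x \<Longrightarrow> coeff x m = 0"
  by (simp add: supp_def)

instantiation skew :: (field) ab_group_add
begin

lift_definition zero_skew :: "'a skew" is "\<lambda>_. 0"
  by simp

lift_definition plus_skew :: "'a skew \<Rightarrow> 'a skew \<Rightarrow> 'a skew" is "\<lambda>f g m. f m + g m"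
proof -
  fix f g :: "'a aut \<Rightarrow> 'a"
  assume "finite {m. f m \<noteq> 0}" "finite {m. g m \<noteq> 0}"
  then show "finite {m. f m + g m \<noteq> 0}"
    by (rule finite_subset[rotated, OF finite_UnI]) auto
qed

lift_definition uminus_skew :: "'a skew \<Rightarrow> 'a skew" is "\<lambda>f m. - f m"
  by simp

definition minus_skew :: "'a skew \<Rightarrow> 'a skew \<Rightarrow> 'a skew"
  where "minus_skew x y = x + (- y)"

instance
  by standard (simp add: minus_skew_def | transfer, simp add: algebra_simps fun_eq_iff)+

end

lemma coeff_0 [simp]: "coeff 0 m = 0"
  by transfer simp

lemma coeff_add [simp]: "coeff (x + y) m = coeff x m + coeff y m"
  by transfer simp

lemma coeff_uminus [simp]: "coeff (- x) m = - coeff x m"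
  by transfer simp

lemma coeff_sum: "coeff (\<Sum>i\<in>I. f i) m = (\<Sum>i\<in>I. coeff (f i) m)"
  by (induction I rule: infinite_finite_induct) auto

instantiation skew :: (field) ring_1
begin

lift_definition one_skew :: "'a skew" is "\<lambda>m. if m = 1 then 1 else 0"
  by simp

text \<open>\<open>(a m) (b n) = a m(b) (m n)\<close>, extended biadditively; below \<open>n = m\<^sup>-\<^sup>1 p\<close>.\<close>

lift_definition times_skew :: "'a skew \<Rightarrow> 'a skew \<Rightarrow> 'a skew" is
  "\<lambda>f g p. \<Sum>m | f m \<noteq> 0. f m * app m (g (inverse m * p))"
proof -
  fix f g :: "'a aut \<Rightarrow> 'a"
  assume fin: "finite {m. f m \<noteq> 0}" "finite {m. g m \<noteq> 0}"
  have "{p. (\<Sum>m | f m \<noteq> 0. f m * app m (g (inverse m * p))) \<noteq> 0}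
      \<subseteq> (\<lambda>(m, n). m * n) ` ({m. f m \<noteq> 0} \<times> {m. g m \<noteq> 0})"
  proof
    fix p assume "p \<in> {p. (\<Sum>m | f m \<noteq> 0. f m * app m (g (inverse m * p))) \<noteq> 0}"
    then obtain m where "f m \<noteq> 0" "f m * app m (g (inverse m * p)) \<noteq> 0"
      by (smt (verit) mem_Collect_eq sum.neutral)
    then show "p \<in> (\<lambda>(m, n). m * n) ` ({m. f m \<noteq> 0} \<times> {m. g m \<noteq> 0})"
      by (intro image_eqI[of _ _ "(m, inverse m * p)"]) auto
  qed
  then show "finite {p. (\<Sum>m | f m \<noteq> 0. f m * app m (g (inverse m * p))) \<noteq> 0}"
    using fin by (meson finite_SigmaI finite_imageI finite_subset)
qed

lemma coeff_one_skew: "coeff 1 m = (if m = 1 then 1 else 0)"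
  by transfer simp

lemma coeff_times_skew:
  "coeff (x * y) p = (\<Sum>m\<in>supp x. coeff x m * app m (coeff y (inverse m * p)))"
  unfolding supp_def by transfer simp

lemma coeff_times_skew_superset:
  assumes "finite T" "supp x \<subseteq> T"
  shows "coeff (x * y) p = (\<Sum>m\<in>T. coeff x m * app m (coeff y (inverse m * p)))"
  unfolding coeff_times_skew
  by (rule sum.mono_neutral_left) (use assms in \<open>auto simp: coeff_outside\<close>)

lemma supp_times_subset: "supp (x * y) \<subseteq> (\<lambda>(m, n). m * n) ` (supp x \<times> supp y)"
proof
  fix p assume "p \<in> supp (x * y)"
  then have "coeff (x * y) p \<noteq> 0" by (simp add: supp_def)
  then obtain m where "m \<in> supp x" "coeff x m * app m (coeff y (inverse m * p)) \<noteq> 0"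
    unfolding coeff_times_skew by (meson sum.neutral)
  then show "p \<in> (\<lambda>(m, n). m * n) ` (supp x \<times> supp y)"
    by (intro image_eqI[of _ _ "(m, inverse m * p)"]) (auto simp: supp_def)
qed

instance
proof
  fix x y z :: "'a skew"
  show "x * y * z = x * (y * z)"
  proof (rule skew_eqI)
    fix p
    define T where "T = (\<lambda>(m, n). m * n) ` (supp x \<times> supp y)"
    have T: "finite T" by (simp add: T_def)
    have "coeff (x * y * z) p
        = (\<Sum>r\<in>T. \<Sum>m\<in>supp x. coeff x m * app m (coeff y (inverse m * r)) * app r (coeff z (inverse r * p)))"
      by (subst coeff_times_skew_superset[OF T])
        (auto simp: T_def coeff_times_skew sum_distrib_right intro: supp_times_subset[THEN subsetD])
    also have "\<dots> = (\<Sum>m\<in>supp x. \<Sum>r\<in>T. coeff x m * app m (coeff y (inverse m * r)) * app r (coeff z (inverse r * p)))"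
      by (rule sum.swap)
    also have "\<dots> = (\<Sum>m\<in>supp x. coeff x m * app m (coeff (y * z) (inverse m * p)))"
    proof (rule sum.cong[OF refl])
      fix m assume m: "m \<in> supp x"
      have inj: "inj_on ((*) m) (supp y)"
        by (rule inj_onI) (metis aut_left_inverse_assoc)
      have "(\<Sum>r\<in>T. coeff x m * app m (coeff y (inverse m * r)) * app r (coeff z (inverse r * p)))
          = (\<Sum>r\<in>(*) m ` supp y. coeff x m * app m (coeff y (inverse m * r)) * app r (coeff z (inverse r * p)))"
      proof (rule sum.mono_neutral_right[OF T])
        show "(*) m ` supp y \<subseteq> T" using m by (auto simp: T_def)
        show "\<forall>r\<in>T - (*) m ` supp y.
            coeff x m * app m (coeff y (inverse m * r)) * app r (coeff z (inverse r * p)) = 0"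
        proof
          fix r assume "r \<in> T - (*) m ` supp y"
          then have "inverse m * r \<notin> supp y"
            by (metis Diff_iff aut_right_inverse_assoc imageI)
          then show "coeff x m * app m (coeff y (inverse m * r)) * app r (coeff z (inverse r * p)) = 0"
            by (simp add: coeff_outside)
        qed
      qed
      also have "\<dots> = (\<Sum>n\<in>supp y. coeff x m * app m (coeff y n) * app (m * n) (coeff z (inverse (m * n) * p)))"
        by (subst sum.reindex[OF inj]) simp
      also have "\<dots> = coeff x m * app m (coeff (y * z) (inverse m * p))"
        by (simp add: coeff_times_skew app_sum sum_distrib_left aut_inverse_times mult.assoc)
      finally show "(\<Sum>r\<in>T. coeff x m * app m (coeff y (inverse m * r)) * app r (coeff z (inverse r * p)))
          = coeff x m * app m (coeff (y * z) (inverse m * p))" .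
    qed
    also have "\<dots> = coeff (x * (y * z)) p"
      by (simp only: coeff_times_skew)
    finally show "coeff (x * y * z) p = coeff (x * (y * z)) p" .
  qed
  have supp1: "supp (1 :: 'a skew) \<subseteq> {1}"
    by (auto simp: supp_def coeff_one_skew)
  show "1 * x = x"
    by (rule skew_eqI) (simp add: coeff_times_skew_superset[OF _ supp1] coeff_one_skew)
  show "x * 1 = x"
  proof (rule skew_eqI)
    fix p
    have eq: "inverse m * p = 1 \<longleftrightarrow> m = p" for m :: "'a aut"
      by (metis aut_left_inverse aut_right_inverse_assoc mult.right_neutral)
    have "coeff (x * 1) p = (\<Sum>m\<in>supp x. if m = p then coeff x m else 0)"
      by (simp add: coeff_times_skew coeff_one_skew eq if_distrib[of "app _"] if_distrib[of "(*) _"] cong: if_cong)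
    also have "\<dots> = coeff x p"
      by (simp add: coeff_outside)
    finally show "coeff (x * 1) p = coeff x p" .
  qed
  show "(x + y) * z = x * z + y * z"
  proof (rule skew_eqI)
    fix p
    have "supp (x + y) \<subseteq> supp x \<union> supp y"
      by (auto simp: supp_def)
    then show "coeff ((x + y) * z) p = coeff (x * z + y * z) p"
      by (simp add: coeff_times_skew_superset[of "supp x \<union> supp y"] distrib_right sum.distrib)
  qed
  show "x * (y + z) = x * y + x * z"
    by (rule skew_eqI) (simp add: coeff_times_skew distrib_left sum.distrib)
  show "(0 :: 'a skew) \<noteq> 1"
    by (metis coeff_0 coeff_one_skew zero_neq_one)
qed

end

text \<open>The monomial \<open>a m\<close>.\<close>

definition monom :: "'a::field \<Rightarrow> 'a aut \<Rightarrow> 'a skew"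
  where "monom a m = Abs_skew (\<lambda>n. if n = m then a else 0)"

hide_const (open) Polynomial.monom

abbreviation scal :: "'a::field \<Rightarrow> 'a skew"
  where "scal a \<equiv> monom a 1"

lemma coeff_monom: "coeff (monom a m) n = (if n = m then a else 0)"
  by (simp add: monom_def Abs_skew_inverse)

lemma supp_monom: "supp (monom a m) \<subseteq> {m}"
  by (auto simp: supp_def coeff_monom)

lemma coeff_monom_mult: "coeff (monom a m * x) p = a * app m (coeff x (inverse m * p))"
  by (simp add: coeff_times_skew_superset[OF _ supp_monom] coeff_monom)

lemma monom_mult_monom: "monom a m * monom b n = monom (a * app m b) (m * n)"
proof (rule skew_eqI)
  fix p
  have "inverse m * p = n \<longleftrightarrow> p = m * n"
    by (metis aut_left_inverse_assoc aut_right_inverse_assoc)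
  then show "coeff (monom a m * monom b n) p = coeff (monom (a * app m b) (m * n)) p"
    by (simp add: coeff_monom_mult coeff_monom)
qed

definition skew_ring :: "'a::field aut set \<Rightarrow> 'a skew set"
  where "skew_ring N = {x. supp x \<subseteq> N}"

text \<open>The action \<open>g(l m) = g(l) g m g\<^sup>-\<^sup>1\<close>: the coefficient of \<open>n\<close> in \<open>g(x)\<close> is \<open>g\<close> of the coefficient of
  \<open>g\<^sup>-\<^sup>1 n g\<close> in \<open>x\<close>.\<close>

lift_definition act :: "'a::field aut \<Rightarrow> 'a skew \<Rightarrow> 'a skew" is
  "\<lambda>g f n. app g (f (inverse g * n * g))"
proof -
  fix g :: "'a aut" and f :: "'a aut \<Rightarrow> 'a"
  assume "finite {m. f m \<noteq> 0}"
  moreover have "{n. app g (f (inverse g * n * g)) \<noteq> 0} \<subseteq> (\<lambda>m. g * m * inverse g) ` {m. f m \<noteq> 0}"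
  proof
    fix n assume "n \<in> {n. app g (f (inverse g * n * g)) \<noteq> 0}"
    then show "n \<in> (\<lambda>m. g * m * inverse g) ` {m. f m \<noteq> 0}"
      by (intro image_eqI[of _ _ "inverse g * n * g"]) (auto simp: mult.assoc)
  qed
  ultimately show "finite {n. app g (f (inverse g * n * g)) \<noteq> 0}"
    by (meson finite_imageI finite_subset)
qed

lemma act_monom: "act g (monom l m) = monom (app g l) (g * m * inverse g)"
proof (rule skew_eqI)
  fix n
  have "inverse g * n * g = m \<longleftrightarrow> n = g * m * inverse g"
    by (auto simp: mult.assoc)
  then show "coeff (act g (monom l m)) n = coeff (monom (app g l) (g * m * inverse g)) n"
    by (simp add: act.rep_eq coeff_monom)
qed

definition skew_invariants :: "'a::field aut set \<Rightarrow> 'a aut set \<Rightarrow> 'a skew set"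
  where "skew_invariants G N = {x \<in> skew_ring N. \<forall>g\<in>G. act g x = x}"

section \<open>Subrings, spans and finiteness conditions\<close>

definition subring :: "'a::ring_1 set \<Rightarrow> bool"
  where "subring R \<longleftrightarrow> 1 \<in> R \<and> (\<forall>x\<in>R. \<forall>y\<in>R. x - y \<in> R \<and> x * y \<in> R)"

definition left_span :: "'a::ring_1 set \<Rightarrow> 'a set \<Rightarrow> 'a set"
  where "left_span R S = {\<Sum>s\<in>F. r s * s | r F. finite F \<and> F \<subseteq> S \<and> r ` F \<subseteq> R}"

definition right_span :: "'a::ring_1 set \<Rightarrow> 'a set \<Rightarrow> 'a set"
  where "right_span R S = {\<Sum>s\<in>F. s * r s | r F. finite F \<and> F \<subseteq> S \<and> r ` F \<subseteq> R}"

definition left_fg :: "'a::ring_1 set \<Rightarrow> 'a set \<Rightarrow> bool"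
  where "left_fg R V \<longleftrightarrow> (\<exists>F. finite F \<and> V = left_span R F)"

definition right_fg :: "'a::ring_1 set \<Rightarrow> 'a set \<Rightarrow> bool"
  where "right_fg R V \<longleftrightarrow> (\<exists>F. finite F \<and> V = right_span R F)"

definition is_ideal :: "'a::comm_ring_1 set \<Rightarrow> 'a set \<Rightarrow> bool"
  where "is_ideal R I \<longleftrightarrow> I \<subseteq> R \<and> 0 \<in> I \<and> (\<forall>x\<in>I. \<forall>y\<in>I. x + y \<in> I) \<and> (\<forall>r\<in>R. \<forall>x\<in>I. r * x \<in> I)"

definition noetherian :: "'a::comm_ring_1 set \<Rightarrow> bool"
  where "noetherian R \<longleftrightarrow> (\<forall>I. is_ideal R I \<longrightarrow> left_fg R I)"

text \<open>\<open>\<Gamma>\<close> need not be central, so a finitely generated \<open>\<Gamma>\<close>-algebra is one generated as a ring by \<open>\<Gamma>\<close>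
  together with finitely many further elements.\<close>

definition fin_gen_over :: "'a::ring_1 set \<Rightarrow> 'a set \<Rightarrow> bool"
  where "fin_gen_over \<Gamma> U \<longleftrightarrow> (\<exists>F. finite F \<and> U = subring hull (\<Gamma> \<union> F))"

section \<open>Algebras over the ground field inside a field\<close>

text \<open>A \<open>k\<close>-algebra structure on a field \<open>L\<close> is a ring homomorphism \<open>\<phi>\<close> from \<open>k\<close> to \<open>L\<close>.\<close>

definition ring_homomorphism :: "('k::ring_1 \<Rightarrow> 'l::ring_1) \<Rightarrow> bool"
  where "ring_homomorphism \<phi> \<longleftrightarrow>
    \<phi> 1 = 1 \<and> (\<forall>a b. \<phi> (a + b) = \<phi> a + \<phi> b) \<and> (\<forall>a b. \<phi> (a * b) = \<phi> a * \<phi> b)"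

definition subalgebra :: "('k::ring_1 \<Rightarrow> 'l::ring_1) \<Rightarrow> 'l set \<Rightarrow> bool"
  where "subalgebra \<phi> A \<longleftrightarrow> subring A \<and> range \<phi> \<subseteq> A"

definition frac_of :: "'l::field set \<Rightarrow> 'l set"
  where "frac_of \<Gamma> = {a / b | a b. a \<in> \<Gamma> \<and> b \<in> \<Gamma> \<and> b \<noteq> 0}"

definition alg_aut :: "('k \<Rightarrow> 'l::field) \<Rightarrow> 'l aut set"
  where "alg_aut \<phi> = {\<sigma>. \<forall>c. app \<sigma> (\<phi> c) = \<phi> c}"

text \<open>\<open>Aut\<^sub>k \<Lambda>\<close> for a subalgebra \<open>\<Lambda>\<close> with fraction field \<open>L\<close>, each automorphism of \<open>\<Lambda>\<close> being identified with
  its unique extension to \<open>L\<close> (lemma \<open>aut_extension\<close>).\<close>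

definition alg_aut_of :: "('k \<Rightarrow> 'l::field) \<Rightarrow> 'l set \<Rightarrow> 'l aut set"
  where "alg_aut_of \<phi> \<Lambda> = {\<sigma> \<in> alg_aut \<phi>. app \<sigma> ` \<Lambda> = \<Lambda>}"

lemma aut_extension:
  fixes f :: "'l::field \<Rightarrow> 'l"
  assumes \<Lambda>: "subring \<Lambda>" "frac_of \<Lambda> = UNIV"
    and bij: "bij_betw f \<Lambda> \<Lambda>"
    and add: "\<And>a b. a \<in> \<Lambda> \<Longrightarrow> b \<in> \<Lambda> \<Longrightarrow> f (a + b) = f a + f b"
    and mult: "\<And>a b. a \<in> \<Lambda> \<Longrightarrow> b \<in> \<Lambda> \<Longrightarrow> f (a * b) = f a * f b"
  shows "\<exists>!\<sigma>. \<forall>a\<in>\<Lambda>. app \<sigma> a = f a"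
proof -
  have one: "1 \<in> \<Lambda>" and zero: "0 \<in> \<Lambda>" and tms: "\<And>a b. a \<in> \<Lambda> \<Longrightarrow> b \<in> \<Lambda> \<Longrightarrow> a * b \<in> \<Lambda>"
    using \<Lambda>(1) unfolding subring_def by (auto, metis diff_self)
  have pls: "a + b \<in> \<Lambda>" if "a \<in> \<Lambda>" "b \<in> \<Lambda>" for a b
    using \<Lambda>(1) that zero unfolding subring_def by (metis diff_0 diff_minus_eq_add)
  have inj: "inj_on f \<Lambda>" and im: "f ` \<Lambda> = \<Lambda>"
    using bij by (auto simp: bij_betw_def)
  have fin: "f a \<in> \<Lambda>" if "a \<in> \<Lambda>" for a using im that by auto
  have f0: "f 0 = 0" using add[OF zero zero] by (metis add_0 add_cancel_left_left)
  have fn0: "f a \<noteq> 0" if "a \<in> \<Lambda>" "a \<noteq> 0" for a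
    using inj that zero f0 by (metis inj_on_def)
  have f1: "f 1 = 1"
    using mult[OF one one] fn0[OF one] by simp
  have ex: "\<exists>a b. a \<in> \<Lambda> \<and> b \<in> \<Lambda> \<and> b \<noteq> 0 \<and> x = a / b" for x
    using \<Lambda>(2) unfolding frac_of_def by blast
  define nu de where "nu x = (SOME a. \<exists>b. a \<in> \<Lambda> \<and> b \<in> \<Lambda> \<and> b \<noteq> 0 \<and> x = a / b)"
    and "de x = (SOME b. nu x \<in> \<Lambda> \<and> b \<in> \<Lambda> \<and> b \<noteq> 0 \<and> x = nu x / b)" for x
  have nd: "nu x \<in> \<Lambda> \<and> de x \<in> \<Lambda> \<and> de x \<noteq> 0 \<and> x = nu x / de x" for x
  proof -
    have "\<exists>b. nu x \<in> \<Lambda> \<and> b \<in> \<Lambda> \<and> b \<noteq> 0 \<and> x = nu x / b"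
      unfolding nu_def by (rule someI_ex[OF ex])
    then show ?thesis unfolding de_def by (rule someI_ex)
  qed
  define s where "s x = f (nu x) / f (de x)" for x
  have s: "s (a / b) = f a / f b" if "a \<in> \<Lambda>" "b \<in> \<Lambda>" "b \<noteq> 0" for a b
  proof -
    let ?x = "a / b"
    have "nu ?x * b = a * de ?x"
      using nd[of ?x] that by (metis divide_eq_eq mult.commute times_divide_eq_right nonzero_eq_divide_eq)
    then have "f (nu ?x) * f b = f a * f (de ?x)"
      using mult that nd[of ?x] by metis
    then show ?thesis
      unfolding s_def using fn0 nd[of ?x] that by (simp add: frac_eq_eq)
  qed
  have sf: "s a = f a" if "a \<in> \<Lambda>" for a
    using s[OF that one] f1 by simp
  have sadd: "s (x + y) = s x + s y" for x y
  proof -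
    obtain a b c d where x: "a \<in> \<Lambda>" "b \<in> \<Lambda>" "b \<noteq> 0" "x = a / b"
      and y: "c \<in> \<Lambda>" "d \<in> \<Lambda>" "d \<noteq> 0" "y = c / d" using ex by metis
    have "x + y = (a * d + c * b) / (b * d)" using x y by (simp add: add_frac_eq)
    then have "s (x + y) = f (a * d + c * b) / f (b * d)"
      using x y by (simp add: s pls tms)
    also have "\<dots> = s x + s y"
      using x y fn0 by (simp add: s add mult tms add_frac_eq)
    finally show ?thesis .
  qed
  have smult: "s (x * y) = s x * s y" for x y
  proof -
    obtain a b c d where x: "a \<in> \<Lambda>" "b \<in> \<Lambda>" "b \<noteq> 0" "x = a / b"
      and y: "c \<in> \<Lambda>" "d \<in> \<Lambda>" "d \<noteq> 0" "y = c / d" using ex by metis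
    then show ?thesis by (simp add: s mult tms)
  qed
  have "inj s"
  proof (rule injI)
    fix x y assume "s x = s y"
    obtain a b c d where x: "a \<in> \<Lambda>" "b \<in> \<Lambda>" "b \<noteq> 0" "x = a / b"
      and y: "c \<in> \<Lambda>" "d \<in> \<Lambda>" "d \<noteq> 0" "y = c / d" using ex by metis
    then have "f (a * d) = f (c * b)"
      using \<open>s x = s y\<close> fn0 by (simp add: s mult frac_eq_eq)
    then have "a * d = c * b" using inj x y tms by (metis inj_on_def)
    then show "x = y" using x y by (simp add: frac_eq_eq)
  qed
  moreover have "surj s"
  proof (unfold surj_def, intro allI)
    fix y
    obtain c d where y: "c \<in> \<Lambda>" "d \<in> \<Lambda>" "d \<noteq> 0" "y = c / d" using ex by metis
    then obtain a b where "a \<in> \<Lambda>" "b \<in> \<Lambda>" "c = f a" "d = f b" using im by (metis imageE)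
    moreover from this y f0 have "b \<noteq> 0" by auto
    ultimately show "\<exists>x. y = s x" using s y by metis
  qed
  ultimately have ap: "app (Abs_aut s) = s"
    using sadd smult by (intro Abs_aut_inverse) (simp add: bij_def)
  show ?thesis
  proof (rule ex1I[of _ "Abs_aut s"])
    show "\<forall>a\<in>\<Lambda>. app (Abs_aut s) a = f a" by (simp add: ap sf)
  next
    fix \<tau> assume \<tau>: "\<forall>a\<in>\<Lambda>. app \<tau> a = f a"
    show "\<tau> = Abs_aut s"
    proof (rule aut_eqI)
      fix x
      obtain a b where x: "a \<in> \<Lambda>" "b \<in> \<Lambda>" "b \<noteq> 0" "x = a / b" using ex by metis
      then have "app \<tau> x * app \<tau> b = app \<tau> a"
        by (metis app_mult nonzero_eq_divide_eq)
      then show "app \<tau> x = app (Abs_aut s) x"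
        using x(1-3) \<tau> fn0 s[OF x(1-3)] unfolding ap x(4) by (metis nonzero_eq_divide_eq)
    qed
  qed
qed

definition fixed_points :: "'l::field aut set \<Rightarrow> 'l set \<Rightarrow> 'l set"
  where "fixed_points G A = {a \<in> A. \<forall>g\<in>G. app g a = a}"

text \<open>\<open>L\<close> is a finite Galois extension of \<open>K\<close> with Galois group \<open>G\<close>.\<close>

definition finite_galois :: "'l::field set \<Rightarrow> 'l aut set \<Rightarrow> bool"
  where "finite_galois K G \<longleftrightarrow>
    left_fg K UNIV \<and> G = {\<sigma>. \<forall>a\<in>K. app \<sigma> a = a} \<and> fixed_points G UNIV = K"

section \<open>Galois rings and Galois orders\<close>

definition separating :: "'l::field set \<Rightarrow> 'l aut set \<Rightarrow> bool"
  where "separating K N \<longleftrightarrow> (\<forall>m\<in>N. \<forall>m'\<in>N. (\<forall>a\<in>K. app m a = app m' a) \<longrightarrow> m = m')"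

definition conj_stable :: "'l::field aut set \<Rightarrow> 'l aut set \<Rightarrow> bool"
  where "conj_stable G N \<longleftrightarrow> (\<forall>g\<in>G. \<forall>m\<in>N. g * m * inverse g \<in> N)"

definition galois_setting :: "('k::ring_1 \<Rightarrow> 'l::field) \<Rightarrow> 'l set \<Rightarrow> 'l aut set \<Rightarrow> 'l aut set \<Rightarrow> bool"
  where "galois_setting \<phi> \<Gamma> G N \<longleftrightarrow>
    subalgebra \<phi> \<Gamma> \<and> noetherian \<Gamma> \<and> finite_galois (frac_of \<Gamma>) G \<and>
    N \<subseteq> alg_aut \<phi> \<and> submonoid N \<and> separating (frac_of \<Gamma>) N \<and> conj_stable G N"

definition galois_ring ::
    "('k::ring_1 \<Rightarrow> 'l::field) \<Rightarrow> 'l set \<Rightarrow> 'l aut set \<Rightarrow> 'l aut set \<Rightarrow> 'l skew set \<Rightarrow> bool"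
  where "galois_ring \<phi> \<Gamma> G N U \<longleftrightarrow>
    galois_setting \<phi> \<Gamma> G N \<and> subring U \<and>
    scal ` \<Gamma> \<subseteq> U \<and> U \<subseteq> skew_invariants G N \<and>
    right_span (scal ` frac_of \<Gamma>) U = skew_invariants G N \<and>
    left_span (scal ` frac_of \<Gamma>) U = skew_invariants G N"

text \<open>Finite generation of \<open>U\<close> over \<open>\<Gamma>\<close> is a standing assumption on the ambient algebra \<open>U\<close>, not part of
  these predicates; it is imposed separately, by \<open>fin_gen_over\<close>.  It does not pass to corner rings:
  for \<open>\<Gamma> = k[x,y]\<close>, \<open>W\<close> generated by the swap \<open>s\<close>, \<open>M\<close> by the scalings of \<open>x\<close> and of \<open>y\<close> by a non-root of unity,
  \<open>f = (1 - s)/2\<close> and \<open>z\<close> the sum of both scalings and their inverses, the algebra \<open>U\<close> generated by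
  \<open>\<Gamma>\<close>, \<open>s\<close> and \<open>f z f\<close> is a Galois order, but \<open>eUe\<close> is not finitely generated.\<close>

definition galois_order ::
    "('k::ring_1 \<Rightarrow> 'l::field) \<Rightarrow> 'l set \<Rightarrow> 'l aut set \<Rightarrow> 'l aut set \<Rightarrow> 'l skew set \<Rightarrow> bool"
  where "galois_order \<phi> \<Gamma> G N U \<longleftrightarrow>
    galois_ring \<phi> \<Gamma> G N U \<and>
    (\<forall>V. V \<subseteq> skew_invariants G N \<and> left_fg (scal ` frac_of \<Gamma>) V
      \<longrightarrow> left_fg (scal ` \<Gamma>) (U \<inter> V)) \<and>
    (\<forall>V. V \<subseteq> skew_invariants G N \<and> right_fg (scal ` frac_of \<Gamma>) V
      \<longrightarrow> right_fg (scal ` \<Gamma>) (U \<inter> V))"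

section \<open>The idempotent and its corner ring\<close>

text \<open>Inside a group of automorphisms with \<open>W\<close> normalizing \<open>M\<close> and \<open>M \<inter> W = 1\<close>, the semidirect product is the
  internal product \<open>M W\<close>.\<close>

definition semidirect :: "'l::field aut set \<Rightarrow> 'l aut set \<Rightarrow> 'l aut set"
  where "semidirect M W = {m * w | m w. m \<in> M \<and> w \<in> W}"

definition group_algebra :: "('k \<Rightarrow> 'l::field) \<Rightarrow> 'l aut set \<Rightarrow> 'l skew set"
  where "group_algebra \<phi> W = {x \<in> skew_ring W. \<forall>w\<in>W. coeff x w \<in> range \<phi>}"

definition avg :: "'l::field aut set \<Rightarrow> 'l skew"
  where "avg W = scal (1 / of_nat (card W)) * (\<Sum>w\<in>W. monom 1 w)"

definition corner :: "'a::ring_1 \<Rightarrow> 'a set \<Rightarrow> 'a set"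
  where "corner e U = {e * u * e | u. u \<in> U}"

lemma app_of_nat [simp]: "app g (of_nat n) = of_nat n"
  by (induction n) auto

lemma monom_1_mult: "monom 1 g * x = act g x * monom 1 g"
proof (rule skew_eqI)
  fix p
  have "coeff (act g x * monom 1 g) p
      = (\<Sum>m\<in>supp (act g x). if m = p * inverse g then coeff (act g x) m else 0)"
    unfolding coeff_times_skew
  proof (rule sum.cong[OF refl])
    fix m
    have "inverse m * p = g \<longleftrightarrow> m = p * inverse g"
      by (auto simp: mult.assoc aut_inverse_times)
    then show "coeff (act g x) m * app m (coeff (monom 1 g) (inverse m * p))
        = (if m = p * inverse g then coeff (act g x) m else 0)"
      by (simp add: coeff_monom)
  qed
  also have "\<dots> = coeff (act g x) (p * inverse g)"
    by (simp add: coeff_outside)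
  also have "\<dots> = coeff (monom 1 g * x) p"
    by (simp add: act.rep_eq coeff_monom_mult mult.assoc)
  finally show "coeff (monom 1 g * x) p = coeff (act g x * monom 1 g) p" by simp
qed

lemma coeff_mult_monom_1: "coeff (x * monom 1 g) p = coeff x (p * inverse g)"
proof -
  have "act g (act (inverse g) x) = x"
    by (rule skew_eqI) (simp add: act.rep_eq mult.assoc flip: app_times)
  then have "coeff (x * monom 1 g) p = coeff (monom 1 g * act (inverse g) x) p"
    by (simp add: monom_1_mult)
  also have "\<dots> = app g (app (inverse g) (coeff x (g * (inverse g * p) * inverse g)))"
    by (simp add: coeff_monom_mult act.rep_eq aut_inverse_inverse)
  also have "\<dots> = coeff x (p * inverse g)"
    by (simp flip: app_times)
  finally show ?thesis .
qed

locale corner_data =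
  fixes W M :: "'l::field aut set"
  assumes sg: "subgroup W" and fin: "finite W" and card: "of_nat (card W) \<noteq> (0 :: 'l)"
    and cs: "conj_stable W M" and sgM: "subgroup M" and MW: "M \<inter> W = {1}"
begin

abbreviation "c \<equiv> 1 / of_nat (card W) :: 'l"
abbreviation "e \<equiv> avg W"

lemma app_c: "app g c = c"
proof -
  have "app g c * of_nat (card W) = app g (c * of_nat (card W))"
    by (simp only: app_mult app_of_nat)
  also have "\<dots> = c * of_nat (card W)"
    using card by (metis app_1 nonzero_divide_eq_eq)
  finally show ?thesis using card by (metis mult_right_cancel)
qed

lemma scal_c_central: "scal c * x = x * scal c"
proof (rule skew_eqI)
  fix p
  have "coeff (x * scal c) p = (\<Sum>m\<in>supp x. if m = p then coeff x m * c else 0)"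
    unfolding coeff_times_skew
  proof (rule sum.cong[OF refl])
    fix m
    have "inverse m * p = 1 \<longleftrightarrow> m = p"
      by (metis aut_left_inverse aut_right_inverse_assoc mult.right_neutral)
    then show "coeff x m * app m (coeff (scal c) (inverse m * p)) = (if m = p then coeff x m * c else 0)"
      using app_c[of m] by (simp only: coeff_monom split: if_split) auto
  qed
  also have "\<dots> = coeff x p * c" by (simp add: coeff_outside)
  finally show "coeff (scal c * x) p = coeff (x * scal c) p"
    by (simp add: coeff_monom_mult)
qed

lemma inv_W: "w \<in> W \<Longrightarrow> inverse w \<in> W"
  and mult_W: "w \<in> W \<Longrightarrow> v \<in> W \<Longrightarrow> w * v \<in> W"
  and one_W: "1 \<in> W"
  using sg by (auto simp: subgroup_def submonoid_def)

lemma mult_W_image: "w \<in> W \<Longrightarrow> (*) w ` W = W" "w \<in> W \<Longrightarrow> (\<lambda>v. v * w) ` W = W"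
proof -
  assume w: "w \<in> W"
  show "(*) w ` W = W"
    using w inv_W mult_W by (auto intro!: image_eqI[of _ _ "inverse w * _"])
  show "(\<lambda>v. v * w) ` W = W"
    using w inv_W mult_W by (auto intro!: image_eqI[of _ _ "_ * inverse w"] simp: mult.assoc)
qed

lemma monom_e: "w \<in> W \<Longrightarrow> monom 1 w * e = e"
proof -
  assume w: "w \<in> W"
  have "monom 1 w * e = scal c * (monom 1 w * (\<Sum>v\<in>W. monom 1 v))"
    unfolding avg_def by (metis mult.assoc scal_c_central)
  also have "monom 1 w * (\<Sum>v\<in>W. monom 1 v) = (\<Sum>v\<in>W. monom 1 (w * v))"
    by (simp add: sum_distrib_left monom_mult_monom)
  also have "(\<Sum>v\<in>W. monom 1 (w * v)) = (\<Sum>v\<in>(*) w ` W. monom 1 v :: 'l skew)"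
    by (subst sum.reindex) (auto intro: inj_onI simp: aut_cancel_left)
  finally show ?thesis by (simp add: avg_def mult_W_image w)
qed

lemma e_monom: "w \<in> W \<Longrightarrow> e * monom 1 w = e"
proof -
  assume w: "w \<in> W"
  have "e * monom 1 w = scal c * (\<Sum>v\<in>W. monom 1 (v * w))"
    unfolding avg_def
    by (simp add: mult.assoc sum_distrib_right monom_mult_monom)
  also have "(\<Sum>v\<in>W. monom 1 (v * w)) = (\<Sum>v\<in>(\<lambda>v. v * w) ` W. monom 1 v :: 'l skew)"
    by (subst sum.reindex) (auto intro: inj_onI simp: aut_cancel_right)
  finally show ?thesis by (simp add: avg_def mult_W_image w)
qed

lemma e_idem: "e * e = e"
proof -
  have "e * e = scal c * ((\<Sum>w\<in>W. monom 1 w) * e)"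
    by (metis avg_def mult.assoc)
  also have "(\<Sum>w\<in>W. monom 1 w) * e = (\<Sum>w\<in>W. monom 1 w * e)"
    by (rule sum_distrib_right)
  also have "(\<Sum>w\<in>W. monom 1 w * e) = of_nat (card W) * e"
    using monom_e by simp
  also have "scal c * (of_nat (card W) * e) = (scal c * of_nat (card W)) * e" by (rule mult.assoc [symmetric])
  also have "scal c * of_nat (card W) = (1 :: 'l skew)"
  proof -
    have n: "of_nat n = scal (of_nat n :: 'l)" for n
      by (induction n) (auto intro!: skew_eqI simp: coeff_monom coeff_one_skew)
    show ?thesis
      unfolding n monom_mult_monom using card by (intro skew_eqI) (simp add: coeff_monom coeff_one_skew)
  qed
  finally show ?thesis by simp
qed

lemma e_commute: "x \<in> skew_invariants W M \<Longrightarrow> e * x = x * e"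
proof -
  assume x: "x \<in> skew_invariants W M"
  then have w: "monom 1 w * x = x * monom 1 w" if "w \<in> W" for w
    using that by (simp add: monom_1_mult skew_invariants_def)
  have "e * x = scal c * ((\<Sum>w\<in>W. monom 1 w) * x)"
    by (metis avg_def mult.assoc)
  also have "(\<Sum>w\<in>W. monom 1 w) * x = x * (\<Sum>w\<in>W. monom 1 w)"
    using w by (simp add: sum_distrib_right sum_distrib_left)
  also have "scal c * (x * (\<Sum>w\<in>W. monom 1 w)) = x * e"
    unfolding avg_def by (metis mult.assoc scal_c_central)
  finally show ?thesis .
qed

lemma exe: "x \<in> skew_invariants W M \<Longrightarrow> e * x * e = x * e"
  by (simp only: e_commute mult.assoc[of x] e_idem)

lemma coeff_mult_e: "coeff (x * e) p = c * (\<Sum>w\<in>W. coeff x (p * inverse w))"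
proof -
  have "x * e = scal c * (\<Sum>w\<in>W. x * monom 1 w)"
    unfolding avg_def sum_distrib_left [symmetric] by (metis mult.assoc scal_c_central)
  then show ?thesis
    by (simp add: coeff_monom_mult coeff_sum coeff_mult_monom_1)
qed

lemma factor_unique: "m \<in> M \<Longrightarrow> w \<in> W \<Longrightarrow> v \<in> W \<Longrightarrow> m * w * inverse v \<in> M \<Longrightarrow> v = w"
proof -
  assume a: "m \<in> M" "w \<in> W" "v \<in> W" "m * w * inverse v \<in> M"
  then have "inverse m * (m * w * inverse v) \<in> M"
    using sgM by (auto simp: subgroup_def submonoid_def)
  then have "w * inverse v \<in> M \<inter> W"
    using a inv_W mult_W by (simp add: mult.assoc)
  then have "w * inverse v = 1" using MW by auto
  then show "v = w"
    by (metis aut_cancel_right aut_right_inverse)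
qed

lemma corner_iso:
  "bij_betw (\<lambda>x. e * x * e) (skew_invariants W M) (corner e (skew_ring (semidirect M W)))"
  unfolding bij_betw_def
proof
  have co: "coeff (x * e) (m * w) = c * coeff x m"
    if x: "x \<in> skew_ring M" and "m \<in> M" "w \<in> W" for x m w
  proof -
    have "(\<Sum>v\<in>W. coeff x (m * w * inverse v)) = (\<Sum>v\<in>W. if v = w then coeff x m else 0)"
    proof (rule sum.cong[OF refl])
      fix v assume v: "v \<in> W"
      show "coeff x (m * w * inverse v) = (if v = w then coeff x m else 0)"
      proof (cases "v = w")
        case True then show ?thesis by (simp add: mult.assoc)
      next
        case False
        then have "m * w * inverse v \<notin> M" using factor_unique that v by blast
        then show ?thesis using x False by (auto simp: skew_ring_def supp_def)
      qed
    qed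
    then show ?thesis using that fin by (simp add: coeff_mult_e)
  qed
  show "inj_on (\<lambda>x. e * x * e) (skew_invariants W M)"
  proof (rule inj_onI)
    fix x y assume xy: "x \<in> skew_invariants W M" "y \<in> skew_invariants W M" "e * x * e = e * y * e"
    then have eq: "x * e = y * e" by (simp add: exe)
    have sup: "x \<in> skew_ring M" "y \<in> skew_ring M" using xy by (auto simp: skew_invariants_def)
    show "x = y"
    proof (rule skew_eqI)
      fix m
      show "coeff x m = coeff y m"
      proof (cases "m \<in> M")
        case True
        then have "c * coeff x m = c * coeff y m"
          using co[OF sup(1) True one_W] co[OF sup(2) True one_W] eq by simp
        then show ?thesis using card by simp
      next
        case False
        then have "m \<notin> supp x" "m \<notin> supp y" using sup by (auto simp: skew_ring_def)
        then show ?thesis by (simp add: coeff_outside)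
      qed
    qed
  qed
  have sup_e: "e \<in> skew_ring W"
  proof -
    have "coeff e p = 0" if "p \<notin> W" for p
    proof -
      have "(\<Sum>w\<in>W. coeff (monom 1 w) p) = (0 :: 'l)"
        using that by (intro sum.neutral) (auto simp: coeff_monom)
      then show ?thesis by (simp add: avg_def coeff_monom_mult coeff_sum)
    qed
    then show ?thesis by (auto simp: skew_ring_def supp_def)
  qed
  show "(\<lambda>x. e * x * e) ` skew_invariants W M = corner e (skew_ring (semidirect M W))"
  proof
    have "M \<subseteq> semidirect M W" unfolding semidirect_def using one_W by force
    then have "skew_invariants W M \<subseteq> skew_ring (semidirect M W)"
      by (auto simp: skew_invariants_def skew_ring_def)
    then show "(\<lambda>x. e * x * e) ` skew_invariants W M \<subseteq> corner e (skew_ring (semidirect M W))"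
      by (auto simp: corner_def)
  next
    show "corner e (skew_ring (semidirect M W)) \<subseteq> (\<lambda>x. e * x * e) ` skew_invariants W M"
    proof
      fix y assume "y \<in> corner e (skew_ring (semidirect M W))"
      then obtain u where u: "u \<in> skew_ring (semidirect M W)" and y: "y = e * u * e"
        by (auto simp: corner_def)
      have supy: "coeff y p = 0" if p: "p \<notin> semidirect M W" for p
      proof (rule ccontr)
        assume "coeff y p \<noteq> 0"
        then have "p \<in> supp (e * u * e)" by (simp add: y supp_def)
        then obtain q v where q: "q \<in> supp (e * u)" and v: "v \<in> W" and p': "p = q * v"
          using supp_times_subset[of "e * u" e, THEN subsetD] sup_e by (fastforce simp: skew_ring_def)
        then obtain w m v' where "w \<in> W" "m \<in> M" "v' \<in> W" "q = w * (m * v')"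
          using supp_times_subset[of e u, THEN subsetD, OF q] sup_e u
          by (fastforce simp: skew_ring_def semidirect_def)
        then have "p = (w * m * inverse w) * (w * v' * v)" "w * m * inverse w \<in> M" "w * v' * v \<in> W"
          using cs v p' mult_W by (auto simp: mult.assoc conj_stable_def)
        then show False using p by (auto simp: semidirect_def)
      qed
      have yw: "y * monom 1 w = y" and wy: "monom 1 w * y = y" if "w \<in> W" for w
        using that by (simp_all add: y mult.assoc e_monom) (simp add: mult.assoc [symmetric] monom_e)
      have right: "coeff y (p * w) = coeff y p" if "w \<in> W" for p w
        using coeff_mult_monom_1[of y w "p * w"] yw[OF that] by (simp add: mult.assoc)
      have left: "app w (coeff y p) = coeff y (w * p)" if "w \<in> W" for p w
        using coeff_monom_mult[of 1 w y "w * p"] wy[OF that] by simp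
      define x where "x = Abs_skew (\<lambda>m. if m \<in> M then of_nat (card W) * coeff y m else 0)"
      have x: "coeff x m = (if m \<in> M then of_nat (card W) * coeff y m else 0)" for m
      proof -
        have "finite {m. (if m \<in> M then of_nat (card W) * coeff y m else 0) \<noteq> 0}"
          by (rule finite_subset[OF _ finite_supp[of y]]) (auto simp: supp_def split: if_splits)
        then show ?thesis by (simp add: x_def Abs_skew_inverse)
      qed
      have xM: "x \<in> skew_ring M" by (auto simp: skew_ring_def supp_def x split: if_splits)
      have "act w x = x" if w: "w \<in> W" for w
      proof (rule skew_eqI)
        fix n
        have iw: "inverse w \<in> W" using inv_W w by simp
        have 1: "inverse w * n * w \<in> M \<longleftrightarrow> n \<in> M"
        proof
          assume "n \<in> M"
          then show "inverse w * n * w \<in> M"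
            using cs iw unfolding conj_stable_def by (metis aut_inverse_inverse)
        next
          assume "inverse w * n * w \<in> M"
          then have "w * (inverse w * n * w) * inverse w \<in> M" using cs w by (auto simp: conj_stable_def)
          then show "n \<in> M" by (simp add: mult.assoc)
        qed
        have 2: "app w (coeff y (inverse w * n * w)) = coeff y n"
          using right[OF w] left[OF w] by (simp add: mult.assoc)
        show "coeff (act w x) n = coeff x n"
          by (simp add: act.rep_eq x 1 2)
      qed
      then have xi: "x \<in> skew_invariants W M" using xM by (simp add: skew_invariants_def)
      have "x * e = y"
      proof (rule skew_eqI)
        fix p
        show "coeff (x * e) p = coeff y p"
        proof (cases "p \<in> semidirect M W")
          case True
          then obtain m w where "p = m * w" "m \<in> M" "w \<in> W" by (auto simp: semidirect_def)
          then show ?thesis using co[OF xM] card by (simp add: x right)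
        next
          case False
          have "coeff x (p * inverse w) = 0" if "w \<in> W" for w
          proof -
            have "p * inverse w \<notin> M"
            proof
              assume "p * inverse w \<in> M"
              moreover have "p = p * inverse w * w" by (simp add: mult.assoc)
              ultimately show False using False that unfolding semidirect_def by blast
            qed
            then show ?thesis by (simp add: x)
          qed
          then show ?thesis using False by (simp add: coeff_mult_e supy)
        qed
      qed
      then have "y = e * x * e" by (simp add: exe xi)
      then show "y \<in> (\<lambda>x. e * x * e) ` skew_invariants W M" using xi by blast
    qed
  qed
qed

lemma corner_iso_hom:
  assumes "x \<in> skew_invariants W M" "y \<in> skew_invariants W M"
  shows "e * (x + y) * e = e * x * e + e * y * e"
    and "e * (x * y) * e = (e * x * e) * (e * y * e)"
    and "e * 1 * e = e"
proof -
  show "e * (x * y) * e = (e * x * e) * (e * y * e)"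
    by (metis assms e_commute e_idem mult.assoc)
qed (simp_all add: algebra_simps e_idem)

end

text \<open>
  \<open>eUe\<close> regarded as a subset of \<open>(L * M)\<^sup>W\<close>, along the isomorphism \<open>x \<mapsto> e x e\<close> from \<open>(L * M)\<^sup>W\<close> onto
  \<open>e (L * (M \<rtimes> W)) e\<close> (lemmas \<open>corner_iso\<close> and \<open>corner_iso_hom\<close>).
\<close>

definition corner_in_invariants :: "'l::field aut set \<Rightarrow> 'l aut set \<Rightarrow> 'l skew set \<Rightarrow> 'l skew set"
  where "corner_in_invariants M W U =
    the_inv_into (skew_invariants W M) (\<lambda>x. avg W * x * avg W) ` corner (avg W) U"

end

theory Submission
  imports Defs
begin

text \<open>
  Multiplication by \<open>e\<close> embeds \<open>R = (L * M)\<^sup>W\<close> into \<open>L * (M \<rtimes> W)\<close>, and \<open>eUe\<close> becomes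
  \<open>U' = {x \<in> R. x e \<in> U}\<close>.  Since every nonzero element of \<open>\<Lambda>\<close> divides a nonzero one of \<open>\<Lambda>\<^sup>W\<close> (its norm),
  denominators can be cleared inside \<open>\<Lambda>\<^sup>W\<close>, which gives \<open>K U' = R = U' K\<close>.  For the order condition let \<open>V\<close> be
  a finite dimensional left \<open>K\<close>-space in \<open>R\<close>.  Then \<open>(U' \<inter> V) e\<close> lies in \<open>U \<inter> L V e\<close>, a finitely generated
  module over the Noetherian ring \<open>\<Lambda>\<close>, so that finitely many \<open>n\<^sub>i e\<close> in it span it with coefficients
  in \<open>\<Lambda>\<close>.  As \<open>e \<lambda> e = \<rho>(\<lambda>) e\<close> for the Reynolds operator \<open>\<rho>\<close>, multiplying \<open>n e = \<Sum>\<lambda>\<^sub>i n\<^sub>i e\<close> by \<open>e\<close> on the left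
  gives \<open>n = \<Sum>\<rho>(\<lambda>\<^sub>i) n\<^sub>i\<close>: the \<open>n\<^sub>i\<close> generate over \<open>\<Lambda>\<^sup>W\<close>.  The same averaging shows that \<open>\<Lambda>\<^sup>W\<close> is Noetherian.
\<close>

section \<open>Spans and Noetherian modules\<close>

text \<open>Adding one term at a time gives an induction that tolerates repeated generators. The
  free operation \<open>scale\<close> lets left multiplication, right multiplication and the ring
  itself share one theory.\<close>

inductive_set lin_span :: "('a \<Rightarrow> 'm \<Rightarrow> 'm) \<Rightarrow> 'a set \<Rightarrow> 'm set \<Rightarrow> 'm::ab_group_add set"
  for scale A S where
  zero: "0 \<in> lin_span scale A S"
| add: "a \<in> A \<Longrightarrow> s \<in> S \<Longrightarrow> x \<in> lin_span scale A S \<Longrightarrow> scale a s + x \<in> lin_span scale A S"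

lemma lin_span_mono: "A \<subseteq> B \<Longrightarrow> S \<subseteq> T \<Longrightarrow> lin_span scale A S \<subseteq> lin_span scale B T"
proof
  fix x assume "A \<subseteq> B" "S \<subseteq> T" and x: "x \<in> lin_span scale A S"
  from x show "x \<in> lin_span scale B T"
    by induction (use \<open>A \<subseteq> B\<close> \<open>S \<subseteq> T\<close> in \<open>auto intro: lin_span.intros\<close>)
qed

lemma lin_span_plus:
  assumes "x \<in> lin_span scale A S" "y \<in> lin_span scale A S"
  shows "x + y \<in> lin_span scale A S"
  using assms(1) by induction (use assms(2) in \<open>auto simp: add.assoc intro: lin_span.intros\<close>)

lemma lin_span_finite_subset:
  assumes "x \<in> lin_span scale A S"
  shows "\<exists>F. finite F \<and> F \<subseteq> S \<and> x \<in> lin_span scale A F"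
  using assms
proof induction
  case zero
  then show ?case by (intro exI[of _ "{}"]) (auto intro: lin_span.zero)
next
  case (add a s x)
  then obtain F where F: "finite F" "F \<subseteq> S" "x \<in> lin_span scale A F" by blast
  then have "x \<in> lin_span scale A (insert s F)"
    using lin_span_mono[of A A F "insert s F"] by blast
  then show ?case
    using F add by (intro exI[of _ "insert s F"]) (auto intro: lin_span.add)
qed

lemma lin_span_subset:
  assumes "0 \<in> N" "\<And>x y. x \<in> N \<Longrightarrow> y \<in> N \<Longrightarrow> x + y \<in> N" "\<And>a s. a \<in> A \<Longrightarrow> s \<in> S \<Longrightarrow> scale a s \<in> N"
  shows "lin_span scale A S \<subseteq> N"
proof
  fix x assume "x \<in> lin_span scale A S"
  then show "x \<in> N" by induction (use assms in auto)
qed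

lemma subring_0: "subring R \<Longrightarrow> 0 \<in> R"
  and subring_1: "subring R \<Longrightarrow> 1 \<in> R"
  and subring_diff: "subring R \<Longrightarrow> x \<in> R \<Longrightarrow> y \<in> R \<Longrightarrow> x - y \<in> R"
  and subring_mult: "subring R \<Longrightarrow> x \<in> R \<Longrightarrow> y \<in> R \<Longrightarrow> x * y \<in> R"
  unfolding subring_def by (auto, metis diff_self)

lemma subring_uminus: "subring R \<Longrightarrow> x \<in> R \<Longrightarrow> - x \<in> R"
  by (metis diff_0 subring_0 subring_diff)

lemma subring_add: "subring R \<Longrightarrow> x \<in> R \<Longrightarrow> y \<in> R \<Longrightarrow> x + y \<in> R"
  by (metis diff_minus_eq_add subring_diff subring_uminus)

lemma subring_sum: "subring R \<Longrightarrow> (\<And>i. i \<in> I \<Longrightarrow> f i \<in> R) \<Longrightarrow> sum f I \<in> R"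
  by (induction I rule: infinite_finite_induct) (auto intro: subring_0 subring_add)

lemma subring_prod: "subring R \<Longrightarrow> (\<And>i. i \<in> I \<Longrightarrow> f i \<in> R) \<Longrightarrow> prod f I \<in> R"
  by (induction I rule: infinite_finite_induct) (auto intro: subring_1 subring_mult)

context module
begin

text \<open>Bridge to the sums over distinct generators that define \<open>left_span\<close> and
  \<open>right_span\<close>. A repeated generator collects its coefficients, which stay in
  \<open>A\<close> because a subring is closed under addition.\<close>

lemma lin_span_eq_sums:
  assumes A: "subring A"
  shows "lin_span scale A S = {\<Sum>s\<in>F. scale (r s) s | r F. finite F \<and> F \<subseteq> S \<and> r ` F \<subseteq> A}"
    (is "_ = ?sums")
proof
  show "lin_span scale A S \<subseteq> ?sums"
  proof
    fix x assume "x \<in> lin_span scale A S"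
    then show "x \<in> ?sums"
    proof induction
      case zero
      show ?case by (rule CollectI, rule exI, rule exI[of _ "{}"]) simp
    next
      case (add a s x)
      then obtain r F where F: "x = (\<Sum>s\<in>F. scale (r s) s)" "finite F" "F \<subseteq> S" "r ` F \<subseteq> A"
        by blast
      \<comment> \<open>The default 0 outside \<open>F\<close> lets one formula cover both a new
        generator \<open>s\<close> and one already in \<open>F\<close>.\<close>
      define r' where "r' t = (if t = s then a else 0) + (if t \<in> F then r t else 0)" for t
      have "(\<Sum>t\<in>insert s F. scale (r' t) t)
          = (\<Sum>t\<in>insert s F. if t = s then scale a s else 0) + (\<Sum>t\<in>insert s F. if t \<in> F then scale (r t) t else 0)"
        unfolding sum.distrib [symmetric]
        by (rule sum.cong) (auto simp: r'_def scale_left_distrib)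
      also have "(\<Sum>t\<in>insert s F. if t \<in> F then scale (r t) t else 0) = x"
        unfolding F(1) using F(2) by (intro sum.mono_neutral_cong_right) auto
      finally have "scale a s + x = (\<Sum>t\<in>insert s F. scale (r' t) t)" using F by simp
      moreover have "r' ` insert s F \<subseteq> A"
        using F(4) add.hyps(1) A by (force simp: r'_def subring_0 intro: subring_add)
      ultimately show ?case using F add by blast
    qed
  qed
next
  have "(\<Sum>s\<in>F. scale (r s) s) \<in> lin_span scale A S" if "finite F" "F \<subseteq> S" "r ` F \<subseteq> A" for F r
    using that by (induction F) (auto intro: lin_span.intros)
  then show "?sums \<subseteq> lin_span scale A S" by auto
qed

lemma lin_span_base: "1 \<in> A \<Longrightarrow> s \<in> S \<Longrightarrow> s \<in> lin_span scale A S"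
  using lin_span.add[of 1 A s S 0 scale] by (simp add: lin_span.zero)

lemma lin_span_scale:
  assumes "subring A" "a \<in> A" "x \<in> lin_span scale A S"
  shows "scale a x \<in> lin_span scale A S"
  using assms(3)
  by induction (use assms in \<open>auto simp: scale_right_distrib intro: lin_span.intros subring_mult\<close>)

lemma lin_span_trans:
  assumes "subring A" "S \<subseteq> lin_span scale A T"
  shows "lin_span scale A S \<subseteq> lin_span scale A T"
  by (rule lin_span_subset) (use assms in \<open>auto intro: lin_span.zero lin_span_plus lin_span_scale\<close>)

lemma lin_span_diff:
  assumes "subring A" "x \<in> lin_span scale A S" "y \<in> lin_span scale A S"
  shows "x - y \<in> lin_span scale A S"
proof -
  have "- y \<in> lin_span scale A S"
    using lin_span_scale[OF assms(1) subring_uminus[OF assms(1) subring_1[OF assms(1)]] assms(3)] by simp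
  then show ?thesis using lin_span_plus[OF assms(2)] by force
qed

end

lemma left_span_eq_lin_span:
  fixes A S :: "'a::comm_ring_1 set"
  assumes "subring A"
  shows "left_span A S = lin_span (*) A S"
proof -
  interpret module "(*) :: 'a \<Rightarrow> 'a \<Rightarrow> 'a" by standard (simp_all add: algebra_simps)
  show ?thesis unfolding lin_span_eq_sums[OF assms] left_span_def ..
qed

section \<open>Submodules over a Noetherian subring\<close>

context module
begin

text \<open>Induction on the number of generators. The coefficients at the new generator
  \<open>f\<close> form an ideal; lifts of its finitely many generators correct any element of
  \<open>N\<close> to one in the span of the other generators, where the induction hypothesis
  applies.\<close>

lemma noetherian_submodule_fg:
  assumes A: "subring A" "noetherian A" and F: "finite F"
    and N: "N \<subseteq> lin_span scale A F" "0 \<in> N" "\<And>x y. x \<in> N \<Longrightarrow> y \<in> N \<Longrightarrow> x + y \<in> N"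
      "\<And>a x. a \<in> A \<Longrightarrow> x \<in> N \<Longrightarrow> scale a x \<in> N"
  shows "\<exists>G. finite G \<and> G \<subseteq> N \<and> N \<subseteq> lin_span scale A G"
  using F N
proof (induction F arbitrary: N)
  case empty
  have "lin_span scale A {} \<subseteq> {0}" by (rule lin_span_subset) auto
  then show ?case using empty by (intro exI[of _ "{}"]) (auto intro: lin_span.zero)
next
  case (insert f F)
  note N = insert.prems
  let ?P = "lin_span scale A F"
  note P = lin_span_plus[of _ scale A F] lin_span_scale[OF A(1), of _ _ F] lin_span.zero[of scale A F]
  have "lin_span scale A (insert f F) \<subseteq> {scale a f + y | a y. a \<in> A \<and> y \<in> ?P}" (is "_ \<subseteq> ?Q")
  proof (rule lin_span_subset)
    show "0 \<in> ?Q" using subring_0[OF A(1)] P(3) by force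
    show "x + y \<in> ?Q" if xy: "x \<in> ?Q" "y \<in> ?Q" for x y
    proof -
      from xy obtain a b u v where "x = scale a f + u" "y = scale b f + v" "a \<in> A" "b \<in> A" "u \<in> ?P" "v \<in> ?P"
        by blast
      then have "x + y = scale (a + b) f + (u + v)" "a + b \<in> A" "u + v \<in> ?P"
        using A P by (auto simp: scale_left_distrib intro: subring_add)
      then show ?thesis by blast
    qed
    show "scale a s \<in> ?Q" if as: "a \<in> A" "s \<in> insert f F" for a s
    proof (cases "s = f")
      case True
      then show ?thesis using as P(3) by force
    next
      case False
      then have "scale a s = scale 0 f + scale a s" "scale a s \<in> ?P"
        using as P(2) lin_span_base[OF subring_1[OF A(1)]] False by auto
      then show ?thesis using subring_0[OF A(1)] by blast
    qed
  qed
  then have NQ: "\<exists>a y. a \<in> A \<and> y \<in> ?P \<and> x = scale a f + y" if "x \<in> N" for x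
    using N(1) that by blast
  define I where "I = {a \<in> A. \<exists>y\<in>?P. scale a f + y \<in> N}"
  have "is_ideal A I"
    unfolding is_ideal_def
  proof (intro conjI ballI)
    show "I \<subseteq> A" by (auto simp: I_def)
    show "0 \<in> I" using A P N(2) by (force simp: I_def subring_0)
  next
    fix a b assume "a \<in> I" "b \<in> I"
    then obtain u v where uv: "a \<in> A" "b \<in> A" "u \<in> ?P" "v \<in> ?P" "scale a f + u \<in> N" "scale b f + v \<in> N"
      by (auto simp: I_def)
    then have "scale (a + b) f + (u + v) \<in> N"
      using N(3)[OF uv(5,6)] by (simp add: scale_left_distrib algebra_simps)
    then show "a + b \<in> I" using uv A P by (auto simp: I_def intro: subring_add)
  next
    fix r a assume r: "r \<in> A" and "a \<in> I"
    then obtain u where u: "a \<in> A" "u \<in> ?P" "scale a f + u \<in> N"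
      by (auto simp: I_def)
    then have "scale (r * a) f + scale r u \<in> N"
      using N(4)[OF r u(3)] by (simp add: scale_right_distrib)
    then show "r * a \<in> I" using u r A P by (auto simp: I_def intro: subring_mult)
  qed
  then obtain H where H: "finite H" "I = lin_span (*) A H"
    using A unfolding noetherian_def left_fg_def by (metis left_span_eq_lin_span)
  interpret base: module "(*) :: 'a \<Rightarrow> 'a \<Rightarrow> 'a" by standard (simp_all add: algebra_simps)
  have "H \<subseteq> I" using H base.lin_span_base subring_1[OF A(1)] by blast
  then have "\<forall>h\<in>H. \<exists>y. y \<in> ?P \<and> scale h f + y \<in> N" by (auto simp: I_def)
  then obtain y where y: "\<And>h. h \<in> H \<Longrightarrow> y h \<in> ?P \<and> scale h f + y h \<in> N" by metis
  define n where "n h = scale h f + y h" for h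
  obtain G where G: "finite G" "G \<subseteq> N \<inter> ?P" "N \<inter> ?P \<subseteq> lin_span scale A G"
    using insert.IH[of "N \<inter> ?P"] N P by auto
  let ?G = "G \<union> n ` H"
  \<comment> \<open>Each element of the ideal is realized as a coefficient at \<open>f\<close> by a
    combination of the lifts \<open>n h\<close> alone.\<close>
  have lift: "\<exists>z\<in>lin_span scale A (n ` H) \<inter> N. \<exists>u\<in>?P. z = scale a f + u" if "a \<in> lin_span (*) A H" for a
    using that
  proof induction
    case zero
    then show ?case using lin_span.zero[of scale A "n ` H"] P(3) N(2) by force
  next
    case (add b h a)
    then obtain z u where z: "z \<in> lin_span scale A (n ` H)" "z \<in> N" "u \<in> ?P" "z = scale a f + u"
      by blast
    have "scale b (n h) + z = scale (b * h + a) f + (scale b (y h) + u)"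
      by (simp add: z(4) n_def scale_right_distrib scale_left_distrib)
    moreover have "scale b (y h) + u \<in> ?P" using y add z P by blast
    moreover have "scale b (n h) + z \<in> N" using y add z N n_def by auto
    moreover have "scale b (n h) + z \<in> lin_span scale A (n ` H)"
      using add z by (auto intro: lin_span.add)
    ultimately show ?case by blast
  qed
  have "N \<subseteq> lin_span scale A ?G"
  proof
    fix x assume x: "x \<in> N"
    then obtain a v where a: "a \<in> A" "v \<in> ?P" "x = scale a f + v" using NQ by blast
    then have "a \<in> lin_span (*) A H" using x H(2) by (auto simp: I_def)
    then obtain z u where z: "z \<in> lin_span scale A (n ` H)" "z \<in> N" "u \<in> ?P" "z = scale a f + u"
      using lift by blast
    have "- z = scale (- 1) z" by simp
    then have "x - z \<in> N"
      using N(3)[OF x N(4)[OF subring_uminus[OF A(1) subring_1[OF A(1)]] z(2)]] by simp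
    moreover have "x - z \<in> ?P" using lin_span_diff[OF A(1) a(2) z(3)] a z by simp
    ultimately have "x - z \<in> lin_span scale A G" using G by blast
    then have "x - z \<in> lin_span scale A ?G" "z \<in> lin_span scale A ?G"
      using lin_span_mono[of A A G ?G scale] lin_span_mono[of A A "n ` H" ?G scale] z by auto
    then have "(x - z) + z \<in> lin_span scale A ?G" by (rule lin_span_plus)
    then show "x \<in> lin_span scale A ?G" by simp
  qed
  moreover have "?G \<subseteq> N" using G y by (auto simp: n_def)
  ultimately show ?case using G H by (intro exI[of _ ?G]) auto
qed

text \<open>The generators come from \<open>S\<close> itself, which need not be a submodule: the
  span of \<open>S\<close> is finitely generated, and each of its generators involves only finitely
  many elements of \<open>S\<close>.\<close>

lemma noetherian_finite_spanning_subset: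
  assumes A: "subring A" "noetherian A" and F: "finite F" and S: "S \<subseteq> lin_span scale A F"
  shows "\<exists>G. finite G \<and> G \<subseteq> S \<and> S \<subseteq> lin_span scale A G"
proof -
  have "\<exists>H. finite H \<and> H \<subseteq> lin_span scale A S \<and> lin_span scale A S \<subseteq> lin_span scale A H"
    by (rule noetherian_submodule_fg[OF A F lin_span_trans[OF A(1) S]])
      (auto intro: lin_span.zero lin_span_plus lin_span_scale A(1))
  then obtain H where H: "finite H" "H \<subseteq> lin_span scale A S" "lin_span scale A S \<subseteq> lin_span scale A H"
    by blast
  have "\<forall>h\<in>H. \<exists>G. finite G \<and> G \<subseteq> S \<and> h \<in> lin_span scale A G"
    by (intro ballI lin_span_finite_subset) (use H in blast)
  then obtain g where g: "\<And>h. h \<in> H \<Longrightarrow> finite (g h) \<and> g h \<subseteq> S \<and> h \<in> lin_span scale A (g h)"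
    by metis
  let ?G = "\<Union>h\<in>H. g h"
  have "H \<subseteq> lin_span scale A ?G"
  proof
    fix h assume "h \<in> H"
    then show "h \<in> lin_span scale A ?G"
      using g[of h] lin_span_mono[of A A "g h" ?G scale] by blast
  qed
  then have "S \<subseteq> lin_span scale A ?G"
    using lin_span_trans[OF A(1)] H lin_span_base[OF subring_1[OF A(1)]] by blast
  then show ?thesis using g H by (intro exI[of _ ?G]) blast
qed

text \<open>The averaging argument: \<open>p\<close> restores the elements of \<open>S\<close> while turning coefficients in \<open>A\<close>
  into coefficients in the subring \<open>B\<close>.\<close>

lemma reynolds_finite_spanning_subset:
  assumes A: "subring A" "noetherian A" and F: "finite F" and S: "S \<subseteq> lin_span scale A F"
    and p: "p 0 = 0" "\<And>x y. p (x + y) = p x + p y" "\<And>s. s \<in> S \<Longrightarrow> p s = s"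
      "\<And>a s. a \<in> A \<Longrightarrow> s \<in> S \<Longrightarrow> p (scale a s) = scale (\<rho> a) s"
    and \<rho>: "\<And>a. a \<in> A \<Longrightarrow> \<rho> a \<in> B"
  shows "\<exists>G. finite G \<and> G \<subseteq> S \<and> S \<subseteq> lin_span scale B G"
proof -
  obtain G where G: "finite G" "G \<subseteq> S" "S \<subseteq> lin_span scale A G"
    using noetherian_finite_spanning_subset[OF A F S] by blast
  have "p x \<in> lin_span scale B G" if "x \<in> lin_span scale A G" for x
    using that
    by induction (use G p \<rho> in \<open>auto simp: subset_iff intro: lin_span.intros\<close>)
  then have "S \<subseteq> lin_span scale B G" using G p(3) by (metis subset_iff)
  then show ?thesis using G by blast
qed

end

section \<open>Artin's theorem\<close>

lemma app_prod: "app v (\<Prod>i\<in>I. f i) = (\<Prod>i\<in>I. app v (f i))"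
  by (induction I rule: infinite_finite_induct) auto

text \<open>An effective form of the independence of characters: the list of pairs encodes a tensor
  whose function \<open>v \<mapsto> \<Sum>v(a) b\<close> is 1 at \<tau> and 0 on the rest of
  \<open>T\<close>. The automorphisms other than \<tau> are killed one by one.\<close>

lemma aut_dual_system:
  fixes \<tau> :: "'l::field aut"
  assumes "finite T"
  shows "\<exists>xs. (\<Sum>(a, b)\<leftarrow>xs. app \<tau> a * b) = 1
    \<and> (\<forall>v\<in>T. v \<noteq> \<tau> \<longrightarrow> (\<Sum>(a, b)\<leftarrow>xs. app v a * b) = 0)"
  using assms
proof (induction T)
  case empty
  then show ?case by (intro exI[of _ "[(1, 1)]"]) simp
next
  case (insert w T)
  then obtain xs where xs: "(\<Sum>(a, b)\<leftarrow>xs. app \<tau> a * b) = 1"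
    "\<And>v. v \<in> T \<Longrightarrow> v \<noteq> \<tau> \<Longrightarrow> (\<Sum>(a, b)\<leftarrow>xs. app v a * b) = 0" by blast
  show ?case
  proof (cases "w = \<tau>")
    case True
    then show ?thesis using xs by blast
  next
    case False
    then obtain t where t: "app w t \<noteq> app \<tau> t" using aut_eqI by blast
    define d where "d = app \<tau> t - app w t"
    have d: "d \<noteq> 0" using t by (simp add: d_def)
    \<comment> \<open>multiplies the function \<open>v \<mapsto> \<Sum>v(a) b\<close> by \<open>v \<mapsto> (v(t) - w(t)) / d\<close>\<close>
    define ys where "ys = map (\<lambda>(a, b). (a * t, b / d)) xs @ map (\<lambda>(a, b). (a, - (app w t * b / d))) xs"
    have ys: "(\<Sum>(a, b)\<leftarrow>ys. app v a * b) = (\<Sum>(a, b)\<leftarrow>xs. app v a * b) * ((app v t - app w t) / d)" for v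
    proof -
      have "(\<Sum>(a, b)\<leftarrow>map (\<lambda>(a, b). (a * t, b / d)) zs @ map (\<lambda>(a, b). (a, - (app w t * b / d))) zs. app v a * b)
          = (\<Sum>(a, b)\<leftarrow>zs. app v a * b) * ((app v t - app w t) / d)" for zs
        by (induction zs) (use d in \<open>auto simp: field_simps\<close>)
      then show ?thesis by (simp add: ys_def)
    qed
    have "(\<Sum>(a, b)\<leftarrow>ys. app \<tau> a * b) = 1" using d by (simp add: ys xs) (simp add: d_def)
    moreover have "(\<Sum>(a, b)\<leftarrow>ys. app v a * b) = 0" if "v \<in> insert w T" "v \<noteq> \<tau>" for v
      using that xs by (cases "v = w") (auto simp: ys)
    ultimately show ?thesis by blast
  qed
qed

locale finite_aut_group =
  fixes W :: "'l::field aut set"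
  assumes subgroup_W: "subgroup W" and finite_W: "finite W"
begin

lemma W_inverse: "w \<in> W \<Longrightarrow> inverse w \<in> W"
  and W_mult: "w \<in> W \<Longrightarrow> v \<in> W \<Longrightarrow> w * v \<in> W"
  and W_one: "1 \<in> W"
  using subgroup_W by (auto simp: subgroup_def submonoid_def)

lemma bij_betw_W_mult: "w \<in> W \<Longrightarrow> bij_betw ((*) w) W W"
  by (rule bij_betw_byWitness[where f' = "(*) (inverse w)"]) (auto intro: W_mult W_inverse)

definition tr :: "'l \<Rightarrow> 'l"
  where "tr x = (\<Sum>w\<in>W. app w x)"

definition nrm :: "'l \<Rightarrow> 'l"
  where "nrm x = (\<Prod>w\<in>W. app w x)"

lemma app_tr: "v \<in> W \<Longrightarrow> app v (tr x) = tr x"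
  unfolding tr_def app_sum using sum.reindex_bij_betw[OF bij_betw_W_mult, of v "\<lambda>w. app w x"] by simp

lemma app_nrm: "v \<in> W \<Longrightarrow> app v (nrm x) = nrm x"
  unfolding nrm_def app_prod using prod.reindex_bij_betw[OF bij_betw_W_mult, of v "\<lambda>w. app w x"] by simp

lemma nrm_nonzero: "x \<noteq> 0 \<Longrightarrow> nrm x \<noteq> 0"
  using finite_W by (simp add: nrm_def)

lemma tr_in_fixed_points: "tr x \<in> fixed_points W UNIV"
  by (simp add: fixed_points_def app_tr)

lemma tr_scale: "y \<in> fixed_points W UNIV \<Longrightarrow> tr (x * y) = tr x * y"
  by (simp add: tr_def fixed_points_def sum_distrib_right)

lemma subring_fixed_points: "subring A \<Longrightarrow> subring (fixed_points W A)"
proof -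
  have m: "app w (x - y) = app w x - app w y" for w :: "'l aut" and x y
    by (metis add_diff_cancel app_add diff_add_cancel)
  show "subring A \<Longrightarrow> subring (fixed_points W A)"
    by (auto simp: subring_def fixed_points_def m)
qed

text \<open>Exchange of summation. For a system dual to the identity the right side collapses to
  \<open>x\<close>, so the left side expands \<open>x\<close> with traces as coefficients.\<close>

lemma sum_tr_dual: "(\<Sum>(a, b)\<leftarrow>xs. tr (x * a) * b) = (\<Sum>w\<in>W. app w x * (\<Sum>(a, b)\<leftarrow>xs. app w a * b))"
  by (induction xs) (auto simp: tr_def sum_distrib_right sum_distrib_left sum.distrib algebra_simps)

text \<open>The expansion of \<open>x\<close> by traces uses as vectors only the second components
  \<open>b\<close> of a dual system, a finite set independent of \<open>x\<close>, and its
  coefficients \<open>tr (x * a)\<close> are invariant.\<close>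

lemma left_fg_over_fixed_points: "left_fg (fixed_points W UNIV) UNIV"
proof -
  obtain xs where xs: "(\<Sum>(a, b)\<leftarrow>xs. app 1 a * b) = 1"
    "\<And>v. v \<in> W \<Longrightarrow> v \<noteq> 1 \<Longrightarrow> (\<Sum>(a, b)\<leftarrow>xs. app v a * b) = 0"
    using aut_dual_system[OF finite_W, of 1] by blast
  have "x \<in> lin_span (*) (fixed_points W UNIV) (snd ` set xs)" for x
  proof -
    have "x = (\<Sum>w\<in>W. if w = 1 then x else 0)" using finite_W W_one by simp
    also have "\<dots> = (\<Sum>w\<in>W. app w x * (\<Sum>(a, b)\<leftarrow>xs. app w a * b))"
      by (rule sum.cong) (use xs in auto)
    also have "\<dots> = (\<Sum>(a, b)\<leftarrow>xs. tr (x * a) * b)" by (rule sum_tr_dual [symmetric])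
    finally have "x = (\<Sum>(a, b)\<leftarrow>xs. tr (x * a) * b)" .
    moreover have "(\<Sum>(a, b)\<leftarrow>ys. tr (x * a) * b) \<in> lin_span (*) (fixed_points W UNIV) (snd ` set xs)"
      if "set ys \<subseteq> set xs" for ys
      using that by (induction ys) (force intro: lin_span.intros tr_in_fixed_points)+
    ultimately show ?thesis by (metis order_refl)
  qed
  moreover have "subring (fixed_points W UNIV)"
    by (rule subring_fixed_points) (simp add: subring_def)
  ultimately have "UNIV = left_span (fixed_points W UNIV) (snd ` set xs)"
    by (auto simp: left_span_eq_lin_span)
  then show ?thesis unfolding left_fg_def by blast
qed

text \<open>The trace can be summed over \<open>W\<close> or, since \<sigma> fixes traces, over the
  coset \<open>\<sigma> W\<close>. If \<sigma> were outside \<open>W\<close>, only the first would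
  contain 1, and a system dual to 1 would give both 1 and 0.\<close>

lemma aut_fixing_fixed_points_in:
  assumes \<sigma>: "\<And>x. x \<in> fixed_points W UNIV \<Longrightarrow> app \<sigma> x = x"
  shows "\<sigma> \<in> W"
proof (rule ccontr)
  assume "\<sigma> \<notin> W"
  have n1: "\<sigma> * w \<noteq> 1" if "w \<in> W" for w
    using \<open>\<sigma> \<notin> W\<close> W_inverse[OF that]
    by (metis aut_cancel_right aut_left_inverse)
  obtain xs where xs: "(\<Sum>(a, b)\<leftarrow>xs. app 1 a * b) = 1"
    "\<And>v. v \<in> W \<union> (*) \<sigma> ` W \<Longrightarrow> v \<noteq> 1 \<Longrightarrow> (\<Sum>(a, b)\<leftarrow>xs. app v a * b) = 0"
    using aut_dual_system[of "W \<union> (*) \<sigma> ` W" 1] finite_W by blast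
  have "(\<Sum>(a, b)\<leftarrow>xs. tr a * b) = (\<Sum>w\<in>W. \<Sum>(a, b)\<leftarrow>xs. app w a * b)"
    using sum_tr_dual[of 1 xs] by simp
  also have "\<dots> = (\<Sum>w\<in>W. if w = 1 then 1 else 0)"
    by (rule sum.cong) (use xs in auto)
  also have "\<dots> = 1" using finite_W W_one by simp
  finally have 1: "(\<Sum>(a, b)\<leftarrow>xs. tr a * b) = 1" .
  have "tr a = (\<Sum>w\<in>W. app (\<sigma> * w) a)" for a
    using \<sigma>[OF tr_in_fixed_points[of a]] by (simp add: tr_def app_sum)
  then have "(\<Sum>(a, b)\<leftarrow>ys. tr a * b) = (\<Sum>w\<in>W. \<Sum>(a, b)\<leftarrow>ys. app (\<sigma> * w) a * b)" for ys
    by (induction ys) (auto simp: sum.distrib sum_distrib_right)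
  also have "(\<Sum>w\<in>W. \<Sum>(a, b)\<leftarrow>xs. app (\<sigma> * w) a * b) = 0"
    by (rule sum.neutral) (use xs(2) n1 in blast)
  finally show False using 1 by simp
qed

lemma finite_galois_fixed_points: "finite_galois (fixed_points W UNIV) W"
  using left_fg_over_fixed_points aut_fixing_fixed_points_in
  by (auto simp: finite_galois_def) (auto simp: fixed_points_def)

text \<open>Two elements of \<open>M\<close> that agree on the fixed field differ by an automorphism
  fixing it, which lies in \<open>M \<inter> W\<close>.\<close>

lemma separating_fixed_points:
  assumes M: "subgroup M" "M \<inter> W = {1}"
  shows "separating (fixed_points W UNIV) M"
  unfolding separating_def
proof (intro ballI impI)
  fix m n assume m: "m \<in> M" "n \<in> M" "\<forall>a\<in>fixed_points W UNIV. app m a = app n a"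
  have "app (inverse m * n) a = a" if "a \<in> fixed_points W UNIV" for a
  proof -
    have "app (inverse m * n) a = app (inverse m * m) a" using m that by (simp del: aut_left_inverse)
    then show ?thesis by simp
  qed
  then have "inverse m * n \<in> W" by (rule aut_fixing_fixed_points_in)
  moreover have "inverse m * n \<in> M" using M m by (auto simp: subgroup_def submonoid_def)
  ultimately have "inverse m * n = 1" using M by auto
  then show "m = n" by (metis aut_right_inverse_assoc mult.right_neutral)
qed

end

section \<open>Invariants of a Noetherian domain\<close>

locale finite_aut_group_on = finite_aut_group W for W :: "'l::field aut set" +
  fixes \<Lambda> :: "'l set"
  assumes subring_\<Lambda>: "subring \<Lambda>" and noetherian_\<Lambda>: "noetherian \<Lambda>" and frac_\<Lambda>: "frac_of \<Lambda> = UNIV"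
    and app_\<Lambda>: "w \<in> W \<Longrightarrow> x \<in> \<Lambda> \<Longrightarrow> app w x \<in> \<Lambda>"
    and card_W: "of_nat (card W) \<noteq> (0 :: 'l)" "1 / of_nat (card W) \<in> \<Lambda>"
begin

abbreviation "\<Gamma> \<equiv> fixed_points W \<Lambda>"
abbreviation "K \<equiv> fixed_points W UNIV"

text \<open>Normalized so as to be a \<open>K\<close>-linear projection onto \<open>K\<close>; since
  the inverse of \<open>card W\<close> lies in \<Lambda>, it maps \<Lambda> into \<Gamma>.\<close>

definition reynolds :: "'l \<Rightarrow> 'l"
  where "reynolds x = 1 / of_nat (card W) * tr x"

lemma subring_\<Gamma>: "subring \<Gamma>" and subring_K: "subring K"
  using subring_fixed_points subring_\<Lambda> by (auto simp: subring_def)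

lemma \<Gamma>_subset: "\<Gamma> \<subseteq> K" "\<Gamma> \<subseteq> \<Lambda>"
  by (auto simp: fixed_points_def)

lemma reynolds_K: "reynolds x \<in> K"
proof -
  have "app w (1 / of_nat (card W)) = 1 / of_nat (card W)" for w :: "'l aut"
  proof -
    have "app w (1 / of_nat (card W)) * of_nat (card W) = app w (1 / of_nat (card W) * of_nat (card W))"
      by (simp only: app_mult app_of_nat)
    then show ?thesis using card_W(1) by (simp add: field_simps)
  qed
  then have "app w (1 / of_nat (card W) * tr x) = 1 / of_nat (card W) * tr x" if "w \<in> W" for w
    using app_tr[OF that] by (simp only: app_mult)
  then show ?thesis by (simp add: reynolds_def fixed_points_def)
qed

lemma reynolds_\<Gamma>: "x \<in> \<Lambda> \<Longrightarrow> reynolds x \<in> \<Gamma>"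
proof -
  assume "x \<in> \<Lambda>"
  then have "reynolds x \<in> \<Lambda>"
    unfolding reynolds_def tr_def
    using card_W subring_\<Lambda> by (intro subring_mult subring_sum) (auto intro: app_\<Lambda>)
  then show ?thesis using reynolds_K by (auto simp: fixed_points_def)
qed

lemma reynolds_add: "reynolds (x + y) = reynolds x + reynolds y"
  by (simp add: reynolds_def tr_def sum.distrib algebra_simps)

lemma reynolds_scale: "y \<in> K \<Longrightarrow> reynolds (x * y) = reynolds x * y"
  by (simp add: reynolds_def tr_scale)

lemma reynolds_1: "reynolds 1 = 1"
  using card_W(1) by (simp add: reynolds_def tr_def)

lemma reynolds_fixed: "x \<in> K \<Longrightarrow> reynolds x = x"
  using reynolds_scale[of x 1] by (simp add: reynolds_1)

text \<open>An ideal of \<Gamma> sits in \<Lambda>, which is spanned by 1 over itself, so averaging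
  with \<open>reynolds\<close> applies. The generators are found inside the ideal, although it need
  not be stable under \<Lambda>.\<close>

lemma noetherian_\<Gamma>: "noetherian \<Gamma>"
  unfolding noetherian_def
proof (intro allI impI)
  fix I assume I: "is_ideal \<Gamma> I"
  interpret base: module "(*) :: 'l \<Rightarrow> 'l \<Rightarrow> 'l" by standard (simp_all add: algebra_simps)
  have sub: "I \<subseteq> \<Lambda>" "I \<subseteq> K" using I \<Gamma>_subset by (auto simp: is_ideal_def)
  have "I \<subseteq> lin_span (*) \<Lambda> {1}"
    using sub lin_span.add[of _ \<Lambda> 1 "{1}" 0 "(*)"] by (auto intro: lin_span.zero)
  then have "\<exists>G. finite G \<and> G \<subseteq> I \<and> I \<subseteq> lin_span (*) \<Gamma> G"
    using sub
    by (intro base.reynolds_finite_spanning_subset[OF subring_\<Lambda> noetherian_\<Lambda>, of "{1}" _ reynolds reynolds])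
      (auto simp: reynolds_add reynolds_fixed reynolds_\<Gamma> reynolds_scale subset_iff
        subring_0[OF subring_K])
  then obtain G where G: "finite G" "G \<subseteq> I" "I \<subseteq> lin_span (*) \<Gamma> G" by blast
  moreover have "lin_span (*) \<Gamma> G \<subseteq> I"
    by (rule lin_span_subset) (use I G in \<open>auto simp: is_ideal_def\<close>)
  ultimately show "left_fg \<Gamma> I"
    unfolding left_fg_def left_span_eq_lin_span[OF subring_\<Gamma>] by blast
qed

text \<open>The cofactor is the product of the other conjugates of \<open>b\<close>, which turns
  \<open>b\<close> into its norm.\<close>

lemma \<Gamma>_multiple:
  assumes "b \<in> \<Lambda>" "b \<noteq> 0"
  shows "\<exists>d\<in>\<Lambda>. d * b \<in> \<Gamma> \<and> d * b \<noteq> 0"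
proof
  have 1: "nrm b = (\<Prod>w\<in>W - {1}. app w b) * b"
    unfolding nrm_def using finite_W W_one by (simp add: prod.remove[of W 1] mult.commute)
  show d: "(\<Prod>w\<in>W - {1}. app w b) \<in> \<Lambda>"
    by (rule subring_prod[OF subring_\<Lambda>]) (use assms app_\<Lambda> in auto)
  show "(\<Prod>w\<in>W - {1}. app w b) * b \<in> \<Gamma> \<and> (\<Prod>w\<in>W - {1}. app w b) * b \<noteq> 0"
    using app_nrm[of _ b] nrm_nonzero[of b] d assms subring_mult[OF subring_\<Lambda>]
    unfolding 1 [symmetric] fixed_points_def by (auto simp: 1)
qed

lemma frac_of_\<Gamma>: "frac_of \<Gamma> = K"
proof
  show "frac_of \<Gamma> \<subseteq> K"
  proof
    fix x assume "x \<in> frac_of \<Gamma>"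
    then obtain a b where ab: "x = a / b" "a \<in> \<Gamma>" "b \<in> \<Gamma>" "b \<noteq> 0" by (auto simp: frac_of_def)
    have "app w x = x" if "w \<in> W" for w
    proof -
      have "app w x * app w b = app w a"
        unfolding app_mult [symmetric] using ab by simp
      then show ?thesis using ab that by (auto simp: fixed_points_def field_simps)
    qed
    then show "x \<in> K" by (simp add: fixed_points_def)
  qed
next
  show "K \<subseteq> frac_of \<Gamma>"
  proof
    fix x assume x: "x \<in> K"
    have "x \<in> frac_of \<Lambda>" by (simp add: frac_\<Lambda>)
    then obtain a b where ab: "x = a / b" "a \<in> \<Lambda>" "b \<in> \<Lambda>" "b \<noteq> 0" by (auto simp: frac_of_def)
    \<comment> \<open>With an invariant denominator the numerator becomes invariant as well, being
      \<open>x\<close> times that denominator.\<close>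
    then obtain d where d: "d \<in> \<Lambda>" "d * b \<in> \<Gamma>" "d * b \<noteq> 0" using \<Gamma>_multiple by blast
    have da: "d * a = x * (d * b)" using ab by simp
    have "d * b \<in> K" using d(2) \<Gamma>_subset by blast
    then have "d * a \<in> K" unfolding da by (rule subring_mult[OF subring_K x])
    then have "d * a \<in> \<Gamma>" using d ab subring_mult[OF subring_\<Lambda>] by (auto simp: fixed_points_def)
    moreover have "x = (d * a) / (d * b)" using da d by simp
    ultimately show "x \<in> frac_of \<Gamma>" using d unfolding frac_of_def by blast
  qed
qed

end

section \<open>Descent to the corner\<close>

text \<open>The argument for one side: \<open>scale\<close> is left or right multiplication by scalars, \<open>\<iota>\<close> is
  multiplication by \<open>e\<close> on the other side, which identifies \<open>(L * M)\<^sup>W\<close> with the corner, and \<open>\<pi>\<close> is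
  multiplication by \<open>e\<close> on the same side.\<close>

locale corner_descent = finite_aut_group_on W \<Lambda> + module scale
  for W :: "'l::field aut set" and \<Lambda> and scale :: "'l \<Rightarrow> 'm::ab_group_add \<Rightarrow> 'm" +
  fixes U R :: "'m set" and \<iota> \<pi> :: "'m \<Rightarrow> 'm"
  assumes U_0: "0 \<in> U" and U_add: "x \<in> U \<Longrightarrow> y \<in> U \<Longrightarrow> x + y \<in> U"
    and U_scale: "a \<in> \<Lambda> \<Longrightarrow> x \<in> U \<Longrightarrow> scale a x \<in> U"
    and R_0: "0 \<in> R" and R_add: "x \<in> R \<Longrightarrow> y \<in> R \<Longrightarrow> x + y \<in> R"
    and R_scale: "a \<in> K \<Longrightarrow> x \<in> R \<Longrightarrow> scale a x \<in> R"
    and \<iota>_add: "\<iota> (x + y) = \<iota> x + \<iota> y" and \<iota>_scale: "\<iota> (scale a x) = scale a (\<iota> x)"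
    and \<iota>_inj: "inj_on \<iota> R"
    and \<pi>_add: "\<pi> (x + y) = \<pi> x + \<pi> y"
    and \<pi>_scale: "x \<in> R \<Longrightarrow> \<pi> (scale a (\<iota> x)) = scale (reynolds a) (\<iota> x)"
    and \<iota>_span: "\<iota> ` R \<subseteq> lin_span scale UNIV U"
    and U_order: "finite F \<Longrightarrow> F \<subseteq> \<iota> ` R \<Longrightarrow>
      \<exists>G. finite G \<and> U \<inter> lin_span scale UNIV F = lin_span scale \<Lambda> G"
begin

definition U' :: "'m set"
  where "U' = {x \<in> R. \<iota> x \<in> U}"

lemma \<iota>_0: "\<iota> 0 = 0" and \<pi>_0: "\<pi> 0 = 0"
  using \<iota>_add[of 0 0] \<pi>_add[of 0 0] by auto

text \<open>Every coefficient is a fraction over \<Lambda>, and the denominators met along the sum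
  are multiplied together.\<close>

lemma clear_denominator:
  assumes "y \<in> lin_span scale UNIV U"
  shows "\<exists>b\<in>\<Lambda>. b \<noteq> 0 \<and> scale b y \<in> U"
  using assms
proof induction
  case zero
  then show ?case using subring_1[OF subring_\<Lambda>] by (intro bexI[of _ 1]) (auto simp: U_0)
next
  case (add a s x)
  then obtain b where b: "b \<in> \<Lambda>" "b \<noteq> 0" "scale b x \<in> U" by blast
  have "a \<in> frac_of \<Lambda>" by (simp add: frac_\<Lambda>)
  then obtain p q where pq: "a = p / q" "p \<in> \<Lambda>" "q \<in> \<Lambda>" "q \<noteq> 0" by (auto simp: frac_of_def)
  have "scale (b * q) (scale a s + x) = scale (b * q * a) s + scale (q * b) x"
    by (simp add: scale_right_distrib mult.commute)
  also have "\<dots> = scale (b * p) s + scale q (scale b x)" using pq by simp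
  also have "\<dots> \<in> U"
    by (rule U_add[OF U_scale[OF subring_mult[OF subring_\<Lambda> b(1) pq(2)] add.hyps(2)] U_scale[OF pq(3) b(3)]])
  finally show ?case
    using b pq subring_mult[OF subring_\<Lambda>] by (intro bexI[of _ "b * q"]) auto
qed

text \<open>Scaling by a denominator from \<Lambda> may take \<open>x\<close> out of
  \<open>R\<close>. A multiple of it in \<Gamma> keeps \<open>x\<close> in \<open>R\<close>, moves
  it into \<open>U'\<close>, and can be divided out again over \<open>K\<close>.\<close>

lemma lin_span_U': "lin_span scale K U' = R"
proof
  show "lin_span scale K U' \<subseteq> R"
    by (rule lin_span_subset) (auto simp: U'_def intro: R_0 R_add R_scale)
next
  show "R \<subseteq> lin_span scale K U'"
  proof
    fix x assume x: "x \<in> R"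
    then obtain b where b: "b \<in> \<Lambda>" "b \<noteq> 0" "scale b (\<iota> x) \<in> U"
      using clear_denominator \<iota>_span by blast
    then obtain d where d: "d \<in> \<Lambda>" "d * b \<in> \<Gamma>" "d * b \<noteq> 0" using \<Gamma>_multiple by blast
    have "scale (d * b) (\<iota> x) \<in> U" using U_scale[OF d(1) b(3)] by simp
    then have "scale (d * b) x \<in> U'"
      using R_scale[of "d * b" x] d(2) \<Gamma>_subset x by (auto simp: U'_def \<iota>_scale)
    moreover have "1 / (d * b) \<in> K"
    proof -
      have "1 \<in> \<Gamma>" using subring_1[OF subring_\<Gamma>] .
      then show ?thesis using d unfolding frac_of_\<Gamma> [symmetric] frac_of_def by blast
    qed
    ultimately have "scale (1 / (d * b)) (scale (d * b) x) \<in> lin_span scale K U'"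
      by (intro lin_span_scale[OF subring_K] lin_span_base[OF subring_1[OF subring_K]])
    moreover have "scale (1 / (d * b)) (scale (d * b) x) = scale (1 / (d * b) * (d * b)) x"
      by (rule scale_scale)
    moreover have "1 / (d * b) * (d * b) = 1" using d(3) by simp
    ultimately show "x \<in> lin_span scale K U'" by (metis scale_one)
  qed
qed

lemma \<iota>_lin_span: "\<iota> ` lin_span scale A F = lin_span scale A (\<iota> ` F)"
proof
  have "\<iota> x \<in> lin_span scale A (\<iota> ` F)" if "x \<in> lin_span scale A F" for x
    using that by induction (auto simp: \<iota>_0 \<iota>_add \<iota>_scale intro: lin_span.intros)
  then show "\<iota> ` lin_span scale A F \<subseteq> lin_span scale A (\<iota> ` F)" by blast
next
  show "lin_span scale A (\<iota> ` F) \<subseteq> \<iota> ` lin_span scale A F"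
  proof
    fix y assume "y \<in> lin_span scale A (\<iota> ` F)"
    then show "y \<in> \<iota> ` lin_span scale A F"
    proof induction
      case zero
      show ?case using \<iota>_0 lin_span.zero[of scale A F] by (metis image_eqI)
    next
      case (add a s x)
      then obtain t z where "s = \<iota> t" "t \<in> F" "x = \<iota> z" "z \<in> lin_span scale A F" by blast
      then show ?case
        using add by (intro image_eqI[of _ _ "scale a t + z"]) (auto simp: \<iota>_add \<iota>_scale intro: lin_span.add)
    qed
  qed
qed

text \<open>\<iota> moves the intersection into a \<Lambda>-module that is finitely generated by the
  order condition on \<open>U\<close>; averaging descends to coefficients in \<Gamma>, and
  injectivity of \<iota> brings the result back to \<open>R\<close>.\<close>

lemma U'_order:
  assumes F: "finite F" and VR: "lin_span scale K F \<subseteq> R"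
  shows "\<exists>G. finite G \<and> U' \<inter> lin_span scale K F = lin_span scale \<Gamma> G"
proof -
  let ?V = "lin_span scale K F"
  have "F \<subseteq> R" using VR lin_span_base[OF subring_1[OF subring_K]] by blast
  then obtain H where H: "finite H" "U \<inter> lin_span scale UNIV (\<iota> ` F) = lin_span scale \<Lambda> H"
    using U_order[of "\<iota> ` F"] F by blast
  have "\<iota> ` ?V \<subseteq> lin_span scale UNIV (\<iota> ` F)"
    unfolding \<iota>_lin_span by (rule lin_span_mono) auto
  then have sub: "\<iota> ` (U' \<inter> ?V) \<subseteq> lin_span scale \<Lambda> H"
    unfolding H(2) [symmetric] by (auto simp: U'_def)
  have "\<exists>G. finite G \<and> G \<subseteq> \<iota> ` (U' \<inter> ?V) \<and> \<iota> ` (U' \<inter> ?V) \<subseteq> lin_span scale \<Gamma> G"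
  proof (rule reynolds_finite_spanning_subset[where p = \<pi> and \<rho> = reynolds,
        OF subring_\<Lambda> noetherian_\<Lambda> H(1) sub \<pi>_0 \<pi>_add])
    show "\<pi> s = s" if "s \<in> \<iota> ` (U' \<inter> ?V)" for s
      using that \<pi>_scale[of _ 1] by (auto simp: U'_def reynolds_1)
    show "\<pi> (scale a s) = scale (reynolds a) s" if "s \<in> \<iota> ` (U' \<inter> ?V)" for a s
      using that \<pi>_scale by (auto simp: U'_def)
  qed (rule reynolds_\<Gamma>)
  \<comment> \<open>The generators come from the image of \<open>U' \<inter> ?V\<close> itself,
    hence have preimages there.\<close>
  then obtain G where G: "finite G" "G \<subseteq> U' \<inter> ?V" "\<iota> ` (U' \<inter> ?V) \<subseteq> lin_span scale \<Gamma> (\<iota> ` G)"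
    by (metis finite_subset_image)
  have sup: "lin_span scale \<Gamma> G \<subseteq> U' \<inter> ?V"
  proof (rule lin_span_subset)
    show "0 \<in> U' \<inter> ?V" by (auto simp: U'_def \<iota>_0 R_0 U_0 intro: lin_span.zero)
    show "x + y \<in> U' \<inter> ?V" if "x \<in> U' \<inter> ?V" "y \<in> U' \<inter> ?V" for x y
      using that by (auto simp: U'_def \<iota>_add intro: lin_span_plus R_add U_add)
    show "scale a s \<in> U' \<inter> ?V" if "a \<in> \<Gamma>" "s \<in> G" for a s
    proof -
      have "a \<in> K" "a \<in> \<Lambda>" "s \<in> R" "\<iota> s \<in> U" "s \<in> ?V"
        using that G(2) \<Gamma>_subset by (auto simp: U'_def)
      then show ?thesis
        by (simp add: U'_def \<iota>_scale R_scale U_scale lin_span_scale[OF subring_K])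
    qed
  qed
  moreover have "U' \<inter> ?V \<subseteq> lin_span scale \<Gamma> G"
  proof
    fix x assume x: "x \<in> U' \<inter> ?V"
    then obtain y where y: "y \<in> lin_span scale \<Gamma> G" "\<iota> x = \<iota> y"
      using G(3) unfolding \<iota>_lin_span [symmetric] by blast
    moreover have "x \<in> R" "y \<in> R" using x y sup by (auto simp: U'_def)
    ultimately show "x \<in> lin_span scale \<Gamma> G" using \<iota>_inj by (auto dest: inj_onD)
  qed
  ultimately show ?thesis using G(1) by blast
qed

end

section \<open>The corner of a Galois order\<close>

lemma skew_ring_mono: "N \<subseteq> N' \<Longrightarrow> skew_ring N \<subseteq> skew_ring N'"
  by (auto simp: skew_ring_def)

lemma skew_ring_coeff: "x \<in> skew_ring N \<longleftrightarrow> (\<forall>m. m \<notin> N \<longrightarrow> coeff x m = 0)"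
  by (auto simp: skew_ring_def supp_def)

text \<open>Here \<open>semidirect N N'\<close> serves merely as the product set of two sets of
  automorphisms.\<close>

lemma skew_ring_mult:
  "x \<in> skew_ring N \<Longrightarrow> y \<in> skew_ring N' \<Longrightarrow> x * y \<in> skew_ring (semidirect N N')"
  using supp_times_subset[of x y] by (fastforce simp: skew_ring_def semidirect_def)

lemma skew_ring_diff: "x \<in> skew_ring N \<Longrightarrow> y \<in> skew_ring N \<Longrightarrow> x - y \<in> skew_ring N"
  unfolding minus_skew_def by (simp add: skew_ring_coeff del: add_uminus_conv_diff)

section \<open>The coefficient field inside the skew ring\<close>

lemma scal_add: "scal (a + b) = scal a + scal b"
  by (rule skew_eqI) (simp add: coeff_monom)

lemma scal_mult: "scal (a * b) = scal a * scal b"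
  by (simp add: monom_mult_monom)

lemma scal_1: "scal 1 = 1"
  by (rule skew_eqI) (simp add: coeff_monom coeff_one_skew)

lemma scal_0: "scal 0 = 0"
  by (rule skew_eqI) (simp add: coeff_monom)

lemma scal_sum: "scal (sum f I) = (\<Sum>i\<in>I. scal (f i))"
  by (induction I rule: infinite_finite_induct) (simp_all add: scal_0 scal_add)

lemma scal_in_skew_ring: "1 \<in> N \<Longrightarrow> scal a \<in> skew_ring N"
  by (auto simp: skew_ring_coeff coeff_monom)

abbreviation lscale :: "'l::field \<Rightarrow> 'l skew \<Rightarrow> 'l skew"
  where "lscale a x \<equiv> scal a * x"

abbreviation rscale :: "'l::field \<Rightarrow> 'l skew \<Rightarrow> 'l skew"
  where "rscale a x \<equiv> x * scal a"

interpretation lscale: module lscale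
  by standard (simp_all add: distrib_left distrib_right scal_add scal_mult scal_1 mult.assoc)

text \<open>Right multiplication reverses the order of scalars; it is a module action because
  \<open>L\<close> is commutative.\<close>

interpretation rscale: module rscale
proof
  show "rscale a (rscale b x) = rscale (a * b) x" for a b and x :: "'a skew"
    by (metis mult.assoc mult.commute scal_mult)
qed (simp_all add: distrib_left distrib_right scal_add scal_1)

lemma scal_coefficients:
  assumes "r ` F \<subseteq> scal ` A"
  obtains q where "q ` F \<subseteq> A" "\<And>x. x \<in> F \<Longrightarrow> r x = scal (q x)"
proof -
  from assms have "\<forall>x\<in>F. \<exists>a\<in>A. r x = scal a" by blast
  then obtain q where "\<And>x. x \<in> F \<Longrightarrow> q x \<in> A \<and> r x = scal (q x)" by metis
  then show ?thesis by (intro that[of q]) auto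
qed

lemma left_span_scal: "subring A \<Longrightarrow> left_span (scal ` A) S = lin_span lscale A S"
  unfolding lscale.lin_span_eq_sums left_span_def
proof (intro set_eqI iffI)
  fix x assume "x \<in> {\<Sum>s\<in>F. r s * s | r F. finite F \<and> F \<subseteq> S \<and> r ` F \<subseteq> scal ` A}"
  then obtain r F where x: "x = (\<Sum>s\<in>F. r s * s)" "finite F" "F \<subseteq> S" and r: "r ` F \<subseteq> scal ` A" by blast
  from r obtain q where q: "q ` F \<subseteq> A" "\<And>x. x \<in> F \<Longrightarrow> r x = scal (q x)"
    by (rule scal_coefficients) blast
  then have "x = (\<Sum>s\<in>F. lscale (q s) s)" using x(1) by simp
  then show "x \<in> {\<Sum>s\<in>F. lscale (r s) s | r F. finite F \<and> F \<subseteq> S \<and> r ` F \<subseteq> A}"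
    using q(1) x(2,3) by blast
next
  fix x assume "x \<in> {\<Sum>s\<in>F. lscale (r s) s | r F. finite F \<and> F \<subseteq> S \<and> r ` F \<subseteq> A}"
  then obtain r F where x: "x = (\<Sum>s\<in>F. lscale (r s) s)" "finite F" "F \<subseteq> S" "r ` F \<subseteq> A" by blast
  then show "x \<in> {\<Sum>s\<in>F. r s * s | r F. finite F \<and> F \<subseteq> S \<and> r ` F \<subseteq> scal ` A}"
    by (intro CollectI exI[of _ "\<lambda>s. scal (r s)"] exI[of _ F]) auto
qed

lemma right_span_scal: "subring A \<Longrightarrow> right_span (scal ` A) S = lin_span rscale A S"
  unfolding rscale.lin_span_eq_sums right_span_def
proof (intro set_eqI iffI)
  fix x assume "x \<in> {\<Sum>s\<in>F. s * r s | r F. finite F \<and> F \<subseteq> S \<and> r ` F \<subseteq> scal ` A}"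
  then obtain r F where x: "x = (\<Sum>s\<in>F. s * r s)" "finite F" "F \<subseteq> S" and r: "r ` F \<subseteq> scal ` A" by blast
  from r obtain q where q: "q ` F \<subseteq> A" "\<And>x. x \<in> F \<Longrightarrow> r x = scal (q x)"
    by (rule scal_coefficients) blast
  then have "x = (\<Sum>s\<in>F. rscale (q s) s)" using x(1) by simp
  then show "x \<in> {\<Sum>s\<in>F. rscale (r s) s | r F. finite F \<and> F \<subseteq> S \<and> r ` F \<subseteq> A}"
    using q(1) x(2,3) by blast
next
  fix x assume "x \<in> {\<Sum>s\<in>F. rscale (r s) s | r F. finite F \<and> F \<subseteq> S \<and> r ` F \<subseteq> A}"
  then obtain r F where x: "x = (\<Sum>s\<in>F. rscale (r s) s)" "finite F" "F \<subseteq> S" "r ` F \<subseteq> A" by blast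
  then show "x \<in> {\<Sum>s\<in>F. s * r s | r F. finite F \<and> F \<subseteq> S \<and> r ` F \<subseteq> scal ` A}"
    by (intro CollectI exI[of _ "\<lambda>s. scal (r s)"] exI[of _ F]) auto
qed

section \<open>The idempotent and the ring of invariants\<close>

context corner_data
begin

text \<open>Commutation with the group elements replaces the action, so that closure under products
  becomes plain associativity.\<close>

lemma skew_invariants_iff:
  "x \<in> skew_invariants W M \<longleftrightarrow> x \<in> skew_ring M \<and> (\<forall>w\<in>W. monom 1 w * x = x * monom 1 w)"
proof -
  have "act w x = x \<longleftrightarrow> monom 1 w * x = x * monom 1 w" for w :: "'l aut"
  proof
    assume "monom 1 w * x = x * monom 1 w"
    then have eq: "act w x * monom 1 w = x * monom 1 w" by (simp add: monom_1_mult)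
    show "act w x = x"
    proof (rule skew_eqI)
      fix p
      \<comment> \<open>Right multiplication by \<open>monom 1 w\<close> shifts the support by
        \<open>w\<close>, so evaluation at \<open>p * w\<close> cancels it.\<close>
      have "coeff (act w x * monom 1 w) (p * w) = coeff (x * monom 1 w) (p * w)" using eq by simp
      then show "coeff (act w x) p = coeff x p" by (simp add: coeff_mult_monom_1 mult.assoc)
    qed
  qed (simp add: monom_1_mult)
  then show ?thesis by (auto simp: skew_invariants_def)
qed

lemma M_mult: "semidirect M M \<subseteq> M" and M_one: "1 \<in> M"
  using sgM by (auto simp: semidirect_def subgroup_def submonoid_def)

lemma subring_skew_invariants: "subring (skew_invariants W M)"
  unfolding subring_def
proof (intro conjI ballI)
  show "1 \<in> skew_invariants W M"
    using M_one by (simp add: skew_invariants_iff skew_ring_coeff coeff_one_skew)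
  fix x y assume xy: "x \<in> skew_invariants W M" "y \<in> skew_invariants W M"
  then show "x - y \<in> skew_invariants W M"
    by (simp add: skew_invariants_iff skew_ring_diff left_diff_distrib right_diff_distrib)
  have "x * y \<in> skew_ring M"
    using xy skew_ring_mult[of x M y M] skew_ring_mono[OF M_mult] by (auto simp: skew_invariants_iff)
  moreover have "monom 1 w * (x * y) = x * y * monom 1 w" if "w \<in> W" for w
    using xy that by (metis skew_invariants_iff mult.assoc)
  ultimately show "x * y \<in> skew_invariants W M" by (simp add: skew_invariants_iff)
qed

lemma scal_invariant: "a \<in> fixed_points W UNIV \<Longrightarrow> scal a \<in> skew_invariants W M"
  using M_one by (simp add: skew_invariants_iff scal_in_skew_ring monom_mult_monom fixed_points_def)

text \<open>The case \<open>x = 1\<close> of \<open>coeff_mult_e\<close>. It serves to place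
  \<open>e\<close> in the group algebra, hence in \<open>U\<close>.\<close>

lemma coeff_e: "coeff e p = (if p \<in> W then c else 0)"
proof -
  have eq: "p * inverse w = 1 \<longleftrightarrow> w = p" for w :: "'l aut"
    by (metis aut_cancel_right aut_right_inverse)
  have "coeff e p = c * (\<Sum>w\<in>W. if w = p then 1 else 0)"
    using coeff_mult_e[of 1 p] by (simp add: coeff_one_skew eq)
  then show ?thesis using fin by simp
qed

lemma e_in_skew_ring: "e \<in> skew_ring W"
  by (simp add: skew_ring_coeff coeff_e)

lemma mult_e_inj: "inj_on (\<lambda>x. x * e) (skew_invariants W M)"
proof -
  have "inj_on (\<lambda>x. e * x * e) (skew_invariants W M)" using corner_iso by (simp add: bij_betw_def)
  then show ?thesis by (simp add: inj_on_def exe)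
qed

lemma mult_e_in_skew_ring: "x \<in> skew_invariants W M \<Longrightarrow> x * e \<in> skew_ring (semidirect M W)"
  by (intro skew_ring_mult e_in_skew_ring) (simp add: skew_invariants_def)

text \<open>Invariants commute with \<open>e\<close>, so \<open>e x e = x e\<close>. As
  \<open>e\<close> is in \<open>U\<close>, the corner lies in \<open>U\<close>; conversely an
  \<open>x e\<close> in \<open>U\<close> equals \<open>e (x e) e\<close> and so lies in the corner.
  The bound on the support of \<open>U\<close> puts its corner in the range of the isomorphism that
  is being inverted.\<close>

lemma corner_in_invariants_eq:
  assumes U: "subring U" "e \<in> U" "U \<subseteq> skew_ring (semidirect M W)"
  shows "corner_in_invariants M W U = {x \<in> skew_invariants W M. x * e \<in> U}"
proof -
  let ?f = "\<lambda>x. e * x * e"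
  have inj: "inj_on ?f (skew_invariants W M)"
    and im: "?f ` skew_invariants W M = corner e (skew_ring (semidirect M W))"
    using corner_iso by (auto simp: bij_betw_def)
  have "corner e U \<subseteq> U" using U subring_mult[OF U(1)] by (auto simp: corner_def)
  moreover have "corner e U \<subseteq> ?f ` skew_invariants W M" using U(3) unfolding im corner_def by blast
  moreover have "?f x \<in> corner e U" if "x \<in> skew_invariants W M" "x * e \<in> U" for x
  proof -
    have "?f x = e * (x * e) * e" by (simp add: mult.assoc e_idem)
    then show ?thesis using that by (auto simp: corner_def)
  qed
  ultimately show ?thesis
    unfolding corner_in_invariants_def
    by (auto simp: the_inv_into_f_f[OF inj] exe image_iff) (use the_inv_into_f_f[OF inj] exe in fastforce)+
qed

text \<open>Moving \<open>w\<close> past the scalar applies \<open>w\<close> to it, and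
  \<open>e\<close> then absorbs \<open>w\<close>; the average that remains is the Reynolds
  operator.\<close>

lemma e_scal_e: "e * scal a * e = scal (c * (\<Sum>w\<in>W. app w a)) * e"
proof -
  have "e * scal a * e = scal c * (\<Sum>w\<in>W. monom 1 w * scal a * e)"
    \<comment> \<open>Only the left \<open>e\<close> is expanded; the right one must stay to absorb
      the group elements.\<close>
    unfolding avg_def [of W, THEN arg_cong, of "\<lambda>z. z * scal a * e"]
    by (simp add: mult.assoc sum_distrib_right)
  also have "(\<Sum>w\<in>W. monom 1 w * scal a * e) = (\<Sum>w\<in>W. scal (app w a) * e)"
  proof (rule sum.cong[OF refl])
    fix w assume "w \<in> W"
    have "monom 1 w * scal a = scal (app w a) * monom 1 w" by (simp add: monom_mult_monom)
    then show "monom 1 w * scal a * e = scal (app w a) * e"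
      using monom_e[OF \<open>w \<in> W\<close>] by (simp add: mult.assoc)
  qed
  also have "scal c * \<dots> = scal (c * (\<Sum>w\<in>W. app w a)) * e"
    by (simp only: scal_mult scal_sum sum_distrib_right mult.assoc)
  finally show ?thesis .
qed

end

theorem theorem4p3:
  fixes \<phi> :: "'k::{alg_closed_field,field_char_0} \<Rightarrow> 'l::field"
    and \<Lambda> :: "'l set" and W M :: "'l aut set" and U :: "'l skew set"
  assumes "ring_homomorphism \<phi>"
    and "subalgebra \<phi> \<Lambda>" and "noetherian \<Lambda>" and "frac_of \<Lambda> = UNIV"
    and "subgroup W" and "finite W" and "W \<subseteq> alg_aut_of \<phi> \<Lambda>"
    and "subgroup M" and "M \<subseteq> alg_aut_of \<phi> \<Lambda>"
    and "conj_stable W M"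
    and "\<And>w. w \<in> W \<Longrightarrow> (\<And>m. m \<in> M \<Longrightarrow> w * m * inverse w = m) \<Longrightarrow> w = 1"
    and "M \<inter> W = {1}"
    and "galois_order \<phi> \<Lambda> {1} (semidirect M W) U"
    and "fin_gen_over (scal ` \<Lambda>) U"
    and "group_algebra \<phi> W \<subseteq> U"
  shows "galois_order \<phi> (fixed_points W \<Lambda>) W M (corner_in_invariants M W U)"
proof -
  have \<phi>: "\<phi> 1 = 1" "\<And>a b. \<phi> (a + b) = \<phi> a + \<phi> b" "\<And>a b. \<phi> (a * b) = \<phi> a * \<phi> b"
    and range\<phi>: "range \<phi> \<subseteq> \<Lambda>" and sub\<Lambda>: "subring \<Lambda>"
    using assms(1,2) by (auto simp: ring_homomorphism_def subalgebra_def)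
  have "\<phi> 0 = 0" using \<phi>(2)[of 0 0] by (metis add_0 add_cancel_left_left)
  then have \<phi>nat: "\<phi> (of_nat n) = of_nat n" for n
    by (induction n) (simp_all add: \<phi>)
  have "1 \<in> W" using assms(5) by (simp add: subgroup_def submonoid_def)
  then have "card W \<noteq> 0" using assms(6) by auto
  \<comment> \<open>Characteristic zero makes \<open>card W\<close> invertible in the ground field,
    and \<phi> carries the inverse into \<Lambda>.\<close>
  then have inv: "\<phi> (1 / of_nat (card W)) * of_nat (card W) = 1"
    by (simp add: \<phi>nat [symmetric] \<phi>(3) [symmetric] \<phi>(1))
  then have card: "of_nat (card W) \<noteq> (0 :: 'l)" by (metis mult_zero_right zero_neq_one)
  have c\<phi>: "1 / of_nat (card W) = \<phi> (1 / of_nat (card W))"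
    using inv card by (metis nonzero_eq_divide_eq)
  have app\<Lambda>: "app w x \<in> \<Lambda>" if "w \<in> W" "x \<in> \<Lambda>" for w x
    using assms(7) that by (auto simp: alg_aut_of_def)
  interpret finite_aut_group_on W \<Lambda>
    using assms(3-6) sub\<Lambda> app\<Lambda> card c\<phi> range\<phi> by unfold_locales auto
  interpret corner_data W M
    using assms card by unfold_locales
  let ?R = "skew_invariants W M" and ?N = "semidirect M W"
  have act1: "act 1 x = x" for x :: "'l skew" by (rule skew_eqI) (simp add: act.rep_eq)
  \<comment> \<open>For \<open>U\<close> over \<Lambda> the group is trivial, so its ring of
    invariants is the whole skew ring.\<close>
  have inv1: "skew_invariants {1} N = skew_ring N" for N :: "'l aut set"
    by (simp add: skew_invariants_def act1)
  have subU: "subring U" and \<Lambda>U: "scal ` \<Lambda> \<subseteq> U" and UN: "U \<subseteq> skew_ring ?N"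
    and spans: "right_span (scal ` UNIV) U = skew_ring ?N" "left_span (scal ` UNIV) U = skew_ring ?N"
    and orders: "\<And>V. V \<subseteq> skew_ring ?N \<Longrightarrow> left_fg (scal ` UNIV) V \<Longrightarrow> left_fg (scal ` \<Lambda>) (U \<inter> V)"
      "\<And>V. V \<subseteq> skew_ring ?N \<Longrightarrow> right_fg (scal ` UNIV) V \<Longrightarrow> right_fg (scal ` \<Lambda>) (U \<inter> V)"
    using assms(13) unfolding galois_order_def galois_ring_def inv1 assms(4) by auto
  have subUNIV: "subring (UNIV :: 'l set)" by (simp add: subring_def)
  have "e \<in> group_algebra \<phi> W"
    using e_in_skew_ring c\<phi> by (auto simp: group_algebra_def coeff_e)
  then have eU: "e \<in> U" using assms(15) by blast
  note R = subring_0[OF subring_skew_invariants] subring_add[OF subring_skew_invariants]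
    subring_mult[OF subring_skew_invariants]
  have Re: "e * x = x * e" if "x \<in> ?R" for x using e_commute[OF that] .
  have reyn: "e * scal a * e = scal (reynolds a) * e" for a
    unfolding e_scal_e reynolds_def tr_def ..
  have reyn_comm: "e * scal (reynolds a) = scal (reynolds a) * e" for a
    by (intro Re scal_invariant reynolds_K)
  have imR: "x * e \<in> skew_ring ?N" if "x \<in> ?R" for x
    using mult_e_in_skew_ring[OF that] .
  \<comment> \<open>The skew ring of \<open>?N\<close> is the \<open>L\<close>-span of
    \<open>U\<close> on either side, hence closed under \<open>L\<close>-spans; this admits the
    spaces \<open>L V e\<close> to the order condition on \<open>U\<close>.\<close>
  have spanN: "lin_span lscale UNIV F \<subseteq> skew_ring ?N" "lin_span rscale UNIV F \<subseteq> skew_ring ?N"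
    if "F \<subseteq> skew_ring ?N" for F
    using lscale.lin_span_trans[OF subUNIV, of F U] rscale.lin_span_trans[OF subUNIV, of F U] that spans
    by (simp_all add: left_span_scal right_span_scal subUNIV)
  \<comment> \<open>Left scalars commute with right multiplication by \<open>e\<close>, which
    therefore serves as the embedding, while left multiplication by \<open>e\<close>
    averages.\<close>
  interpret left: corner_descent W \<Lambda> lscale U ?R "\<lambda>x. x * e" "\<lambda>y. e * y"
  proof unfold_locales
    show "\<exists>G. finite G \<and> U \<inter> lin_span lscale UNIV F = lin_span lscale \<Lambda> G"
      if "finite F" "F \<subseteq> (\<lambda>x. x * e) ` ?R" for F
    proof -
      have "F \<subseteq> skew_ring ?N" using that imR by blast
      then have "left_fg (scal ` \<Lambda>) (U \<inter> lin_span lscale UNIV F)"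
        using that spanN by (intro orders) (auto simp: left_fg_def left_span_scal subUNIV)
      then show ?thesis by (auto simp: left_fg_def left_span_scal subring_\<Lambda>)
    qed
    show "e * lscale a (x * e) = lscale (reynolds a) (x * e)" if "x \<in> ?R" for x a
      using reyn[of a] Re[OF that] by (metis mult.assoc)
    show "(\<lambda>x. x * e) ` ?R \<subseteq> lin_span lscale UNIV U"
      using imR spans by (auto simp: left_span_scal subUNIV)
    show "inj_on (\<lambda>x. x * e) ?R" by (rule mult_e_inj)
    show "lscale a x \<in> U" if "a \<in> \<Lambda>" "x \<in> U" for a x
      using that \<Lambda>U subring_mult[OF subU] by blast
    show "lscale a x \<in> ?R" if "a \<in> K" "x \<in> ?R" for a x
      using that scal_invariant R(3) by blast
  qed (auto simp: algebra_simps mult.assoc R(1,2) subring_0[OF subU] subring_add[OF subU])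
  interpret right: corner_descent W \<Lambda> rscale U ?R "\<lambda>x. e * x" "\<lambda>y. y * e"
  proof unfold_locales
    show "\<exists>G. finite G \<and> U \<inter> lin_span rscale UNIV F = lin_span rscale \<Lambda> G"
      if "finite F" "F \<subseteq> (\<lambda>x. e * x) ` ?R" for F
    proof -
      have "F \<subseteq> skew_ring ?N" using that imR Re by auto
      then have "right_fg (scal ` \<Lambda>) (U \<inter> lin_span rscale UNIV F)"
        using that spanN by (intro orders) (auto simp: right_fg_def right_span_scal subUNIV)
      then show ?thesis by (auto simp: right_fg_def right_span_scal subring_\<Lambda>)
    qed
    \<comment> \<open>The identity for \<open>e * scal a * e\<close> leaves the average to the left
      of \<open>e\<close>; being invariant, it commutes with \<open>e\<close> and returns to the
      right.\<close>
    show "rscale a (e * x) * e = rscale (reynolds a) (e * x)" if "x \<in> ?R" for x a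
      using reyn[of a] reyn_comm[of a] Re[OF that] by (metis mult.assoc)
    show "(\<lambda>x. e * x) ` ?R \<subseteq> lin_span rscale UNIV U"
      using imR spans Re by (auto simp: right_span_scal subUNIV)
    show "inj_on (\<lambda>x. e * x) ?R" using mult_e_inj Re by (simp add: inj_on_def)
    show "rscale a x \<in> U" if "a \<in> \<Lambda>" "x \<in> U" for a x
      using that \<Lambda>U subring_mult[OF subU] by blast
    show "rscale a x \<in> ?R" if "a \<in> K" "x \<in> ?R" for a x
      using that scal_invariant R(3) by blast
  qed (auto simp: algebra_simps mult.assoc R(1,2) subring_0[OF subU] subring_add[OF subU])
  let ?U = "corner_in_invariants M W U"
  have U': "?U = {x \<in> ?R. x * e \<in> U}"
    by (rule corner_in_invariants_eq[OF subU eU UN])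
  \<comment> \<open>Both one-sided descriptions give the same set, since \<open>x e = e x\<close> on
    \<open>?R\<close>.\<close>
  have Ul: "left.U' = ?U" and Ur: "right.U' = ?U"
    using Re by (auto simp: U' left.U'_def right.U'_def)
  have "range \<phi> \<subseteq> \<Gamma>"
    using range\<phi> assms(7) by (auto simp: fixed_points_def alg_aut_of_def alg_aut_def)
  then have setting: "galois_setting \<phi> \<Gamma> W M"
    using subring_\<Gamma> noetherian_\<Gamma> finite_galois_fixed_points separating_fixed_points[OF assms(8,12)] assms(8-10)
    by (auto simp: galois_setting_def subalgebra_def frac_of_\<Gamma> subgroup_def alg_aut_of_def)
  have "subring ?U"
    unfolding subring_def
  proof (intro conjI ballI)
    show "1 \<in> ?U" using eU subring_1[OF subring_skew_invariants] by (simp add: U')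
    fix x y assume xy: "x \<in> ?U" "y \<in> ?U"
    show "x - y \<in> ?U"
      using xy subring_diff[OF subring_skew_invariants] subring_diff[OF subU]
      by (simp add: U' left_diff_distrib)
    \<comment> \<open>Sliding one \<open>e\<close> past \<open>y\<close> shows that multiplication
      by \<open>e\<close> respects products of invariants.\<close>
    have "x * y * e = (x * e) * (y * e)"
      using xy Re[of y] by (metis (no_types, lifting) U' mem_Collect_eq mult.assoc e_idem)
    then show "x * y \<in> ?U"
      using xy R(3) subring_mult[OF subU] by (simp add: U')
  qed
  moreover have "scal ` \<Gamma> \<subseteq> ?U"
  proof
    fix y assume "y \<in> scal ` \<Gamma>"
    then obtain a where a: "y = scal a" "a \<in> \<Lambda>" "a \<in> K" using \<Gamma>_subset by blast
    then have "y \<in> U" using \<Lambda>U by blast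
    then show "y \<in> ?U" using a scal_invariant subring_mult[OF subU _ eU] by (simp add: U')
  qed
  moreover have "right_span (scal ` frac_of \<Gamma>) ?U = ?R" "left_span (scal ` frac_of \<Gamma>) ?U = ?R"
    using left.lin_span_U' right.lin_span_U'
    by (simp_all add: frac_of_\<Gamma> left_span_scal right_span_scal subring_K Ul Ur)
  ultimately have "galois_ring \<phi> \<Gamma> W M ?U"
    using setting by (auto simp: galois_ring_def U')
  moreover have "left_fg (scal ` \<Gamma>) (?U \<inter> V)" if "V \<subseteq> ?R" "left_fg (scal ` K) V" for V
    using that left.U'_order
    by (auto simp: left_fg_def left_span_scal subring_\<Gamma> subring_K Ul)
  moreover have "right_fg (scal ` \<Gamma>) (?U \<inter> V)" if "V \<subseteq> ?R" "right_fg (scal ` K) V" for V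
    using that right.U'_order
    by (auto simp: right_fg_def right_span_scal subring_\<Gamma> subring_K Ur)
  ultimately show ?thesis
    by (auto simp: galois_order_def frac_of_\<Gamma>)
qed

end
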